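(* Let $(\mathfrak A[\|\cdot\|_{\mathfrak A}],\mathfrak A_0)$ and $(\mathfrak B[\|\cdot\|_{\mathfrak B}],\mathfrak B_0)$ be (unital) Banach quasi *-algebras that are fully representable and satisfy condition (P). Let $\bar n$ be a uniform cross-norm on $\mathfrak A\otimes\mathfrak B$ and suppose that the normed quasi *-algebra $(\mathfrak A\otimes_{\bar n}\mathfrak B,\mathfrak A_0\otimes\mathfrak B_0)$ is barrelled (i.e. the normed space $\mathfrak A\otimes_{\bar n}\mathfrak B$ is barrelled). Then $(\mathfrak A\otimes_{\bar n}\mathfrak B,\mathfrak A_0\otimes\mathfrak B_0)$ is fully representable.
   Context: All vector spaces are complex. A quasi *-algebra $(\mathfrak A,\mathfrak A_0)$ is a vector space $\mathfrak A$ with a *-algebra $\mathfrak A_0\subseteq\mathfrak A$ (as a subspace) such that: (i) products $ax$, $xa$ ($a\in\mathfrak A$, $x\in\mathfrak A_0$) are defined in $\mathfrak A$ and bilinear, extending the multiplication of $\mathfrak A_0$; (ii) $(xa)y=x(ay)$, $a(xy)=(ax)y$ for $x,y\in\mathfrak A_0$, $a\in\mathfrak A$; (iii) $\mathfrak A$ has an involution extending that of $\mathfrak A_0$ with $(ax)^*=x^*a^*$, $(xa)^*=a^*x^*$. It is unital if there is $e\in\mathfrak A_0$ with $ae=a=ea$ for all $a\in\mathfrak A$. It is a normed (Banach) quasi *-algebra if $\mathfrak A$ carries a (complete) norm with $\|a^*\|=\|a\|$, $\mathfrak A_0$ dense in $\mathfrak A$, and $a\mapsto ax$ continuous for every $x\in\mathfrak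 A_0$. Standing convention: quasi *-algebras are unital, with units of norm $1$. $\mathfrak A\otimes\mathfrak B$ is a quasi *-algebra over $\mathfrak A_0\otimes\mathfrak B_0$ via $(a\otimes b)(x\otimes y)=ax\otimes by$, $(x\otimes y)(a\otimes b)=xa\otimes yb$, $(a\otimes b)^*=a^*\otimes b^*$. A cross-norm $\bar n$ on $\mathfrak A\otimes\mathfrak B$ is a norm with $\|a\otimes b\|_{\bar n}=\|a\|_{\mathfrak A}\|b\|_{\mathfrak B}$; it is uniform if for all bounded linear $T_1:\mathfrak A\to\mathfrak A$, $T_2:\mathfrak B\to\mathfrak B$ the operator $T_1\otimes T_2$ is $\bar n$-bounded and its extension to the completion has norm $\le\|T_1\|\|T_2\|$. $\mathfrak A\otimes_{\bar n}\mathfrak B$ denotes $\mathfrak A\otimes\mathfrak B$ with the norm $\bar n$; it is understood that the involution is $\bar n$-isometric, so that it is a normed quasi *-algebra over $\mathfrak A_0\otimes\mathfrak B_0$. A linear functional $\omega$ on $\mathfrak A$ is representable if: (L.1) $\omega(x^*x)\ge0$ for all $x\in\mathfrak A_0$; (L.2) $\omega(y^*a^*x)=\overline{\omega(x^*ay)}$ for all $x,y\in\mathfrak A_0$, $a\in\mathfrak A$; (L.3) for all $a\in\mathfrak A$ there is $\gamma_a>0$ with $|\omega(a^*x)|\le\gamma_a\,\omega(x^*x)^{1/2}$ for all $x\in\mathfrak A_0$. For a normed quasi *-algebra, $\mathcal R_c(\mathfrak A,\mathfrak A_0)$ denotes the set of continuous representable linear functionals. For $\omega\in\mathcal R_c(\mathfrak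 A,\mathfrak A_0)$ put $\varphi_\omega(x,y)=\omega(y^*x)$ on $\mathfrak A_0\times\mathfrak A_0$; this form is closable and its closure $\overline\varphi_\omega$ has domain $\mathcal D(\overline\varphi_\omega)=\{a\in\mathfrak A:\exists\{x_n\}\subset\mathfrak A_0,\ \|x_n-a\|\to0,\ \varphi_\omega(x_n-x_m,x_n-x_m)\to0\}$. Put $\mathfrak A_{\mathcal R}=\bigcap_{\omega\in\mathcal R_c(\mathfrak A,\mathfrak A_0)}\mathcal D(\overline\varphi_\omega)$ ($=\mathfrak A$ if $\mathcal R_c(\mathfrak A,\mathfrak A_0)=\{0\}$). Let $\mathfrak A^+$ be the norm closure in $\mathfrak A$ of $\{\sum_{k=1}^n x_k^*x_k: x_k\in\mathfrak A_0,\ n\in\mathbb N\}$. $\mathcal R_c(\mathfrak A,\mathfrak A_0)$ is sufficient if for every $0\ne a\in\mathfrak A^+$ there is $\omega\in\mathcal R_c(\mathfrak A,\mathfrak A_0)$ with $\omega(a)>0$. $(\mathfrak A,\mathfrak A_0)$ is fully representable if $\mathcal R_c(\mathfrak A,\mathfrak A_0)$ is sufficient and $\mathfrak A_{\mathcal R}=\mathfrak A$. Condition (P): if $a\in\mathfrak A$ satisfies $\omega(x^*ax)\ge0$ for all $\omega\in\mathcal R_c(\mathfrak A,\mathfrak A_0)$ and all $x\in\mathfrak A_0$, then $a\in\mathfrak A^+$. *)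

theory Defs
  imports "HOL-Analysis.Analysis" "HOL-Library.Poly_Mapping" "HOL-Library.Complex_Order"
begin

section \<open>Complex vector spaces\<close>

text \<open>A complex vector space is also a real one, so that the library notion of convexity applies
  to it.\<close>

class scaleC = scaleR +
  fixes scaleC :: "complex \<Rightarrow> 'a \<Rightarrow> 'a" (infixr \<open>*\<^sub>C\<close> 75)
  assumes scaleR_scaleC: "scaleR r = scaleC (complex_of_real r)"

class complex_vector = scaleC + ab_group_add +
  assumes scaleC_add_right: "c *\<^sub>C (x + y) = c *\<^sub>C x + c *\<^sub>C y"
    and scaleC_add_left: "(c + d) *\<^sub>C x = c *\<^sub>C x + d *\<^sub>C x"
    and scaleC_scaleC: "c *\<^sub>C (d *\<^sub>C x) = (c * d) *\<^sub>C x"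
    and scaleC_one: "1 *\<^sub>C x = x"

subclass (in complex_vector) real_vector
  by standard (simp_all add: scaleR_scaleC scaleC_add_right scaleC_add_left scaleC_scaleC scaleC_one)

global_interpretation complex_vector:
    vector_space "scaleC :: complex \<Rightarrow> 'a \<Rightarrow> 'a::complex_vector"
  by unfold_locales (simp_all add: scaleC_add_right scaleC_add_left scaleC_scaleC scaleC_one)

section \<open>The algebraic tensor product\<close>

text \<open>The free vector space on \<open>'a \<times> 'b\<close> modulo the bilinearity relations.\<close>

definition scale_free :: "complex \<Rightarrow> ('i \<Rightarrow>\<^sub>0 complex) \<Rightarrow> ('i \<Rightarrow>\<^sub>0 complex)" where
  "scale_free c = Poly_Mapping.map ((*) c)"

lemma lookup_scale_free: "Poly_Mapping.lookup (scale_free c p) i = c * Poly_Mapping.lookup p i"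
  unfolding scale_free_def by (simp add: Poly_Mapping.map.rep_eq when_def)

global_interpretation free: vector_space "scale_free :: complex \<Rightarrow> ('i \<Rightarrow>\<^sub>0 complex) \<Rightarrow> _"
  by unfold_locales
    (auto intro!: poly_mapping_eqI simp: lookup_scale_free lookup_add algebra_simps)

abbreviation free_pair :: "'a \<Rightarrow> 'b \<Rightarrow> ('a \<times> 'b) \<Rightarrow>\<^sub>0 complex" where
  "free_pair a b \<equiv> Poly_Mapping.single (a, b) 1"

definition bilinearity_relations ::
    "(('a::complex_vector \<times> 'b::complex_vector) \<Rightarrow>\<^sub>0 complex) set" where
  "bilinearity_relations =
     {free_pair (a + a') b - free_pair a b - free_pair a' b | a a' b. True}
   \<union> {free_pair a (b + b') - free_pair a b - free_pair a b' | a b b'. True}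
   \<union> {free_pair (c *\<^sub>C a) b - scale_free c (free_pair a b) | c a b. True}
   \<union> {free_pair a (c *\<^sub>C b) - scale_free c (free_pair a b) | c a b. True}"

definition tensor_eq ::
    "(('a::complex_vector \<times> 'b::complex_vector) \<Rightarrow>\<^sub>0 complex) \<Rightarrow> (('a \<times> 'b) \<Rightarrow>\<^sub>0 complex) \<Rightarrow> bool"
  where "tensor_eq p q \<longleftrightarrow> p - q \<in> free.span bilinearity_relations"

lemma equivp_tensor_eq:
  "equivp (tensor_eq :: (('a::complex_vector \<times> 'b::complex_vector) \<Rightarrow>\<^sub>0 complex) \<Rightarrow> _)"
  (is "equivp ?R")
proof (rule equivpI)
  show "reflp ?R"
    by (simp add: reflp_def tensor_eq_def free.span_zero)
  show "symp ?R"
    unfolding symp_def tensor_eq_def using free.span_neg by fastforce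
  show "transp ?R"
    unfolding transp_def tensor_eq_def
  proof (intro allI impI)
    fix p q r :: "('a \<times> 'b) \<Rightarrow>\<^sub>0 complex"
    assume "p - q \<in> free.span bilinearity_relations" "q - r \<in> free.span bilinearity_relations"
    from free.span_add[OF this] show "p - r \<in> free.span bilinearity_relations" by simp
  qed
qed

quotient_type (overloaded) ('a, 'b) tensor =
    "('a::complex_vector \<times> 'b::complex_vector) \<Rightarrow>\<^sub>0 complex" / tensor_eq
  by (rule equivp_tensor_eq)

instantiation tensor :: (complex_vector, complex_vector) complex_vector
begin

lift_definition zero_tensor :: "('a, 'b) tensor" is 0 .

lift_definition plus_tensor :: "('a, 'b) tensor \<Rightarrow> ('a, 'b) tensor \<Rightarrow> ('a, 'b) tensor" is "(+)"
  unfolding tensor_eq_def by (simp only: add_diff_add free.span_add)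

lift_definition minus_tensor :: "('a, 'b) tensor \<Rightarrow> ('a, 'b) tensor \<Rightarrow> ('a, 'b) tensor" is "(-)"
proof -
  fix p p' q q' :: "('a \<times> 'b) \<Rightarrow>\<^sub>0 complex"
  assume "tensor_eq p p'" "tensor_eq q q'"
  then have "(p - p') - (q - q') \<in> free.span bilinearity_relations"
    unfolding tensor_eq_def by (rule free.span_diff)
  then show "tensor_eq (p - q) (p' - q')"
    unfolding tensor_eq_def by (simp add: algebra_simps)
qed

lift_definition uminus_tensor :: "('a, 'b) tensor \<Rightarrow> ('a, 'b) tensor" is "uminus"
  unfolding tensor_eq_def by (drule free.span_neg) simp

lift_definition scaleC_tensor :: "complex \<Rightarrow> ('a, 'b) tensor \<Rightarrow> ('a, 'b) tensor" is scale_free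
  unfolding tensor_eq_def by (simp only: free.scale_right_diff_distrib[symmetric] free.span_scale)

definition scaleR_tensor :: "real \<Rightarrow> ('a, 'b) tensor \<Rightarrow> ('a, 'b) tensor" where
  "scaleR_tensor r = scaleC (complex_of_real r)"

instance
proof
  show "((*\<^sub>R) r :: ('a, 'b) tensor \<Rightarrow> _) = (*\<^sub>C) (complex_of_real r)" for r
    by (rule scaleR_tensor_def)
qed (transfer; simp add: tensor_eq_def free.span_zero add.assoc add.commute
    free.scale_right_distrib free.scale_left_distrib)+

end

lift_definition tensor_of :: "'a::complex_vector \<Rightarrow> 'b::complex_vector \<Rightarrow> ('a, 'b) tensor"
  (infixr \<open>\<otimes>\<close> 70) is free_pair .


lemma tensor_add_left: "(a + a') \<otimes> b = a \<otimes> b + a' \<otimes> b"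
  by transfer (unfold tensor_eq_def bilinearity_relations_def diff_diff_eq[symmetric],
      rule free.span_base, blast)

lemma tensor_add_right: "a \<otimes> (b + b') = a \<otimes> b + a \<otimes> b'"
  by transfer (unfold tensor_eq_def bilinearity_relations_def diff_diff_eq[symmetric],
      rule free.span_base, blast)

lemma tensor_scale_left: "(c *\<^sub>C a) \<otimes> b = c *\<^sub>C (a \<otimes> b)"
  by transfer (unfold tensor_eq_def bilinearity_relations_def, rule free.span_base, blast)

lemma tensor_scale_right: "a \<otimes> (c *\<^sub>C b) = c *\<^sub>C (a \<otimes> b)"
  by transfer (unfold tensor_eq_def bilinearity_relations_def, rule free.span_base, blast)

lemma tensor_induct [case_names zero pure add]:
  assumes zero: "P 0" and pure: "\<And>a b. P (a \<otimes> b)" and add: "\<And>s t. P s \<Longrightarrow> P t \<Longrightarrow> P (s + t)"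
  shows "P (t :: ('a::complex_vector, 'b::complex_vector) tensor)"
proof -
  have "P (abs_tensor p)" for p :: "('a \<times> 'b) \<Rightarrow>\<^sub>0 complex"
  proof (induction p rule: update_induct)
    case const
    then show ?case using zero by (simp add: zero_tensor.abs_eq)
  next
    case (update f i c)
    obtain a b where i: "i = (a, b)" by (cases i)
    have "Poly_Mapping.update i c f = f + scale_free c (free_pair a b)"
      using update(1) unfolding i
      by (intro poly_mapping_eqI)
        (auto simp: lookup_update lookup_add lookup_scale_free lookup_single when_def in_keys_iff)
    then have "abs_tensor (Poly_Mapping.update i c f) = abs_tensor f + (c *\<^sub>C a) \<otimes> b"
      unfolding tensor_scale_left by (simp only: plus_tensor.abs_eq scaleC_tensor.abs_eq tensor_of.abs_eq)
    then show ?case using add[OF update(3) pure] by simp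
  qed
  then show ?thesis by (induction t rule: tensor.abs_induct)
qed

theorem tensor_universal_property:
  fixes s :: "complex \<Rightarrow> 'c::ab_group_add \<Rightarrow> 'c"
    and \<phi> :: "'a::complex_vector \<Rightarrow> 'b::complex_vector \<Rightarrow> 'c"
  assumes s: "vector_space s"
    and left: "\<And>b. Vector_Spaces.linear scaleC s (\<lambda>a. \<phi> a b)"
    and right: "\<And>a. Vector_Spaces.linear scaleC s (\<phi> a)"
  shows "\<exists>!F. Vector_Spaces.linear scaleC s F \<and> (\<forall>a b. F (a \<otimes> b) = \<phi> a b)"
proof (rule ex_ex1I)
  interpret s: vector_space s by (rule s)
  interpret left: Vector_Spaces.linear scaleC s "\<lambda>a. \<phi> a b" for b by (rule left)
  interpret right: Vector_Spaces.linear scaleC s "\<phi> a" for a by (rule right)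
  define G where "G p = (\<Sum>i\<in>Poly_Mapping.keys p. s (Poly_Mapping.lookup p i) (\<phi> (fst i) (snd i)))" for p
  have G: "G p = (\<Sum>i\<in>I. s (Poly_Mapping.lookup p i) (\<phi> (fst i) (snd i)))"
    if "finite I" "Poly_Mapping.keys p \<subseteq> I" for p I
    unfolding G_def using that by (intro sum.mono_neutral_left) (auto simp: in_keys_iff)
  have G_add: "G (p + q) = G p + G q" for p q
  proof -
    have fin: "finite (Poly_Mapping.keys p \<union> Poly_Mapping.keys q)" by simp
    show ?thesis
      using keys_add[of p q]
      by (simp add: G[OF fin] lookup_add s.scale_left_distrib sum.distrib)
  qed
  have G_scale: "G (scale_free c p) = s c (G p)" for c p
  proof -
    have "Poly_Mapping.keys (scale_free c p) \<subseteq> Poly_Mapping.keys p"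
      by (auto simp: in_keys_iff lookup_scale_free)
    then have "G (scale_free c p) = (\<Sum>i\<in>Poly_Mapping.keys p. s (c * Poly_Mapping.lookup p i) (\<phi> (fst i) (snd i)))"
      by (simp add: G[OF finite_keys] lookup_scale_free)
    then show ?thesis by (simp add: G_def s.scale_sum_right)
  qed
  interpret G: Vector_Spaces.linear scale_free s G
    by unfold_locales (simp_all add: G_add G_scale)
  have G_pair: "G (free_pair a b) = \<phi> a b" for a b
    by (simp add: G_def)
  have G0: "G p = 0" if "p \<in> free.span bilinearity_relations" for p
    using that
  proof (induction rule: free.span_induct_alt)
    case base
    then show ?case by (rule G.zero)
  next
    case (step c p q)
    have "\<phi> (a + a') b = \<phi> a b + \<phi> a' b" "\<phi> a (b + b') = \<phi> a b + \<phi> a b'"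
      "\<phi> (k *\<^sub>C a) b = s k (\<phi> a b)" "\<phi> a (k *\<^sub>C b) = s k (\<phi> a b)" for a a' b b' k
      by (rule left.add right.add left.scale right.scale)+
    then have "G p = 0"
      using step(1) by (auto simp: bilinearity_relations_def G.diff G.scale G_pair)
    then show ?case using step by (simp add: G.add G.scale)
  qed
  have cong: "G p = G q" if "abs_tensor p = abs_tensor q" for p q
    using that G0[of "p - q"] by (simp add: tensor.abs_eq_iff tensor_eq_def G.diff)
  define F where "F t = G (rep_tensor t)" for t
  have F: "F (abs_tensor p) = G p" for p
    unfolding F_def by (rule cong) (rule Quotient3_abs_rep[OF Quotient3_tensor])
  have "Vector_Spaces.linear scaleC s F"
  proof unfold_locales
    show "F (x + y) = F x + F y" for x y
      by (induction x rule: tensor.abs_induct, induction y rule: tensor.abs_induct)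
        (simp add: F G.add plus_tensor.abs_eq)
    show "F (c *\<^sub>C x) = s c (F x)" for c x
      by (induction x rule: tensor.abs_induct) (simp add: F G.scale scaleC_tensor.abs_eq)
  qed
  then show "\<exists>F. Vector_Spaces.linear scaleC s F \<and> (\<forall>a b. F (a \<otimes> b) = \<phi> a b)"
    by (intro exI[of _ F]) (auto simp: F G_pair tensor_of.abs_eq)
next
  fix F F'
  assume F: "Vector_Spaces.linear scaleC s F \<and> (\<forall>a b. F (a \<otimes> b) = \<phi> a b)"
    and F': "Vector_Spaces.linear scaleC s F' \<and> (\<forall>a b. F' (a \<otimes> b) = \<phi> a b)"
  interpret F: Vector_Spaces.linear scaleC s F using F by blast
  interpret F': Vector_Spaces.linear scaleC s F' using F' by blast
  have "F t = F' t" for t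
    by (induction t rule: tensor_induct) (simp_all add: F F' F.zero F'.zero F.add F'.add)
  then show "F = F'" by blast
qed


definition tensor_map :: "('a \<Rightarrow> 'a) \<Rightarrow> ('b \<Rightarrow> 'b) \<Rightarrow> ('a::complex_vector, 'b::complex_vector) tensor \<Rightarrow> ('a, 'b) tensor"
  where "tensor_map T\<^sub>1 T\<^sub>2 =
    (THE F. Vector_Spaces.linear scaleC scaleC F \<and> (\<forall>a b. F (a \<otimes> b) = T\<^sub>1 a \<otimes> T\<^sub>2 b))"

lemma tensor_map:
  assumes T\<^sub>1: "Vector_Spaces.linear scaleC scaleC T\<^sub>1" and T\<^sub>2: "Vector_Spaces.linear scaleC scaleC T\<^sub>2"
  shows linear_tensor_map: "Vector_Spaces.linear scaleC scaleC (tensor_map T\<^sub>1 T\<^sub>2)"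
    and tensor_map_pure: "tensor_map T\<^sub>1 T\<^sub>2 (a \<otimes> b) = T\<^sub>1 a \<otimes> T\<^sub>2 b"
proof -
  interpret T\<^sub>1: Vector_Spaces.linear scaleC scaleC T\<^sub>1 by (rule T\<^sub>1)
  interpret T\<^sub>2: Vector_Spaces.linear scaleC scaleC T\<^sub>2 by (rule T\<^sub>2)
  have "\<exists>!F. Vector_Spaces.linear scaleC scaleC F \<and> (\<forall>a b. F (a \<otimes> b) = T\<^sub>1 a \<otimes> T\<^sub>2 b)"
    by (rule tensor_universal_property; unfold_locales)
      (simp_all add: T\<^sub>1.add T\<^sub>2.add T\<^sub>1.scale T\<^sub>2.scale tensor_add_left tensor_add_right
        tensor_scale_left tensor_scale_right)
  from theI'[OF this, folded tensor_map_def]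
  show "Vector_Spaces.linear scaleC scaleC (tensor_map T\<^sub>1 T\<^sub>2)" "tensor_map T\<^sub>1 T\<^sub>2 (a \<otimes> b) = T\<^sub>1 a \<otimes> T\<^sub>2 b"
    by blast+
qed

section \<open>Norms\<close>

definition is_norm :: "('a::complex_vector \<Rightarrow> real) \<Rightarrow> bool" where
  "is_norm N \<longleftrightarrow>
     (\<forall>x. N x \<ge> 0) \<and> (\<forall>x. N x = 0 \<longleftrightarrow> x = 0) \<and>
     (\<forall>x y. N (x + y) \<le> N x + N y) \<and> (\<forall>c x. N (c *\<^sub>C x) = cmod c * N x)"

definition norm_topology :: "('a::complex_vector \<Rightarrow> real) \<Rightarrow> 'a topology" where
  "norm_topology N = Metric_space.mtopology UNIV (\<lambda>x y. N (x - y))"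

definition complete_norm :: "('a::complex_vector \<Rightarrow> real) \<Rightarrow> bool" where
  "complete_norm N \<longleftrightarrow> Metric_space.mcomplete UNIV (\<lambda>x y. N (x - y))"

definition bounded_operator :: "('a::complex_vector \<Rightarrow> real) \<Rightarrow> ('a \<Rightarrow> 'a) \<Rightarrow> bool" where
  "bounded_operator N T \<longleftrightarrow>
     Vector_Spaces.linear scaleC scaleC T \<and> (\<exists>K. \<forall>x. N (T x) \<le> K * N x)"

definition operator_norm :: "('a::complex_vector \<Rightarrow> real) \<Rightarrow> ('a \<Rightarrow> 'a) \<Rightarrow> real" where
  "operator_norm N T = (SUP x. N (T x) / N x)"

definition barrel :: "('a::complex_vector \<Rightarrow> real) \<Rightarrow> 'a set \<Rightarrow> bool" where
  "barrel N U \<longleftrightarrow>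
     closedin (norm_topology N) U \<and> convex U \<and>
     (\<forall>c x. cmod c \<le> 1 \<longrightarrow> x \<in> U \<longrightarrow> c *\<^sub>C x \<in> U) \<and>
     (\<forall>x. \<exists>r>0. \<forall>c. cmod c \<le> r \<longrightarrow> c *\<^sub>C x \<in> U)"

definition barrelled :: "('a::complex_vector \<Rightarrow> real) \<Rightarrow> bool" where
  "barrelled N \<longleftrightarrow> (\<forall>U. barrel N U \<longrightarrow> 0 \<in> norm_topology N interior_of U)"

definition cross_norm ::
    "('a::complex_vector \<Rightarrow> real) \<Rightarrow> ('b::complex_vector \<Rightarrow> real) \<Rightarrow> (('a, 'b) tensor \<Rightarrow> real) \<Rightarrow> bool" where
  "cross_norm N\<^sub>A N\<^sub>B n \<longleftrightarrow> is_norm n \<and> (\<forall>a b. n (a \<otimes> b) = N\<^sub>A a * N\<^sub>B b)"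

text \<open>The continuous extension of a bounded operator to the completion has the same norm as the
  operator itself, so the completion does not have to be mentioned.\<close>

definition uniform_cross_norm ::
    "('a::complex_vector \<Rightarrow> real) \<Rightarrow> ('b::complex_vector \<Rightarrow> real) \<Rightarrow> (('a, 'b) tensor \<Rightarrow> real) \<Rightarrow> bool" where
  "uniform_cross_norm N\<^sub>A N\<^sub>B n \<longleftrightarrow> cross_norm N\<^sub>A N\<^sub>B n \<and>
     (\<forall>T\<^sub>1 T\<^sub>2. bounded_operator N\<^sub>A T\<^sub>1 \<longrightarrow> bounded_operator N\<^sub>B T\<^sub>2 \<longrightarrow>
        bounded_operator n (tensor_map T\<^sub>1 T\<^sub>2) \<and>
        operator_norm n (tensor_map T\<^sub>1 T\<^sub>2) \<le> operator_norm N\<^sub>A T\<^sub>1 * operator_norm N\<^sub>B T\<^sub>2)"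

section \<open>Quasi *-algebras\<close>

text \<open>The type \<open>'a\<close> is the vector space \<open>\<AA>\<close> and \<open>core\<close> is the *-algebra \<open>\<AA>\<^sub>0\<close>. A single
  total operation \<open>mult\<close> stands for the partial multiplication of \<open>\<AA>\<close>: its value \<open>a \<cdot> b\<close> is
  meaningful only if \<open>a\<close> or \<open>b\<close> lies in the core, and is otherwise arbitrary.\<close>

record 'a quasi_alg =
  core :: "'a set"
  mult :: "'a \<Rightarrow> 'a \<Rightarrow> 'a" (infixl \<open>\<cdot>\<index>\<close> 70)
  adj :: "'a \<Rightarrow> 'a"
  nrm :: "'a \<Rightarrow> real"

locale quasi_star_algebra =
  fixes A :: "'a::complex_vector quasi_alg" (structure)
  assumes core_subspace: "complex_vector.subspace (core A)"
    and core_mult: "\<lbrakk>x \<in> core A; y \<in> core A\<rbrakk> \<Longrightarrow> x \<cdot> y \<in> core A"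
    and core_adj: "x \<in> core A \<Longrightarrow> adj A x \<in> core A"
    and right_mult_linear: "x \<in> core A \<Longrightarrow> Vector_Spaces.linear scaleC scaleC (\<lambda>a. a \<cdot> x)"
    and left_mult_linear: "x \<in> core A \<Longrightarrow> Vector_Spaces.linear scaleC scaleC (\<lambda>a. x \<cdot> a)"
    and mult_add_core: "\<lbrakk>x \<in> core A; y \<in> core A\<rbrakk> \<Longrightarrow> a \<cdot> (x + y) = a \<cdot> x + a \<cdot> y"
    and mult_scale_core: "x \<in> core A \<Longrightarrow> a \<cdot> (c *\<^sub>C x) = c *\<^sub>C (a \<cdot> x)"
    and core_add_mult: "\<lbrakk>x \<in> core A; y \<in> core A\<rbrakk> \<Longrightarrow> (x + y) \<cdot> a = x \<cdot> a + y \<cdot> a"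
    and core_scale_mult: "x \<in> core A \<Longrightarrow> (c *\<^sub>C x) \<cdot> a = c *\<^sub>C (x \<cdot> a)"
    and mult_assoc_mid: "\<lbrakk>x \<in> core A; y \<in> core A\<rbrakk> \<Longrightarrow> (x \<cdot> a) \<cdot> y = x \<cdot> (a \<cdot> y)"
    and mult_assoc_right: "\<lbrakk>x \<in> core A; y \<in> core A\<rbrakk> \<Longrightarrow> a \<cdot> (x \<cdot> y) = (a \<cdot> x) \<cdot> y"
    and adj_adj: "adj A (adj A a) = a"
    and adj_add: "adj A (a + b) = adj A a + adj A b"
    and adj_scale: "adj A (c *\<^sub>C a) = cnj c *\<^sub>C adj A a"
    and adj_mult_right: "x \<in> core A \<Longrightarrow> adj A (a \<cdot> x) = adj A x \<cdot> adj A a"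
    and adj_mult_left: "x \<in> core A \<Longrightarrow> adj A (x \<cdot> a) = adj A a \<cdot> adj A x"

locale normed_quasi_star_algebra = quasi_star_algebra +
  assumes unital: "\<exists>e\<in>core A. (\<forall>a. a \<cdot> e = a \<and> e \<cdot> a = a) \<and> nrm A e = 1"
    and is_norm: "is_norm (nrm A)"
    and nrm_adj: "nrm A (adj A a) = nrm A a"
    and core_dense: "norm_topology (nrm A) closure_of core A = UNIV"
    and right_mult_continuous: "x \<in> core A \<Longrightarrow>
      continuous_map (norm_topology (nrm A)) (norm_topology (nrm A)) (\<lambda>a. a \<cdot> x)"

locale banach_quasi_star_algebra = normed_quasi_star_algebra +
  assumes complete: "complete_norm (nrm A)"

text \<open>In the following, \<open>\<le>\<close> and \<open><\<close> on the complex numbers are the order of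
  \<^theory>\<open>HOL-Library.Complex_Order\<close>; \<open>0 \<le> z\<close> says that \<open>z\<close> is real and nonnegative.\<close>

definition representable :: "'a::complex_vector quasi_alg \<Rightarrow> ('a \<Rightarrow> complex) \<Rightarrow> bool" where
  "representable A \<omega> \<longleftrightarrow>
     Vector_Spaces.linear scaleC (*) \<omega> \<and>
     (\<forall>x\<in>core A. 0 \<le> \<omega> (adj A x \<cdot>\<^bsub>A\<^esub> x)) \<and>
     (\<forall>x\<in>core A. \<forall>y\<in>core A. \<forall>a.
        \<omega> (adj A y \<cdot>\<^bsub>A\<^esub> adj A a \<cdot>\<^bsub>A\<^esub> x) = cnj (\<omega> (adj A x \<cdot>\<^bsub>A\<^esub> a \<cdot>\<^bsub>A\<^esub> y))) \<and>
     (\<forall>a. \<exists>\<gamma>>0. \<forall>x\<in>core A.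
        cmod (\<omega> (adj A a \<cdot>\<^bsub>A\<^esub> x)) \<le> \<gamma> * sqrt (Re (\<omega> (adj A x \<cdot>\<^bsub>A\<^esub> x))))"

definition cont_representable :: "'a::complex_vector quasi_alg \<Rightarrow> ('a \<Rightarrow> complex) set" where
  "cont_representable A =
     {\<omega>. representable A \<omega> \<and> continuous_map (norm_topology (nrm A)) euclidean \<omega>}"

definition sesq_form :: "'a quasi_alg \<Rightarrow> ('a \<Rightarrow> complex) \<Rightarrow> 'a \<Rightarrow> 'a \<Rightarrow> complex" where
  "sesq_form A \<omega> x y = \<omega> (adj A y \<cdot>\<^bsub>A\<^esub> x)"

definition closure_domain :: "'a::complex_vector quasi_alg \<Rightarrow> ('a \<Rightarrow> complex) \<Rightarrow> 'a set" where
  "closure_domain A \<omega> =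
     {a. \<exists>x :: nat \<Rightarrow> 'a. (\<forall>n. x n \<in> core A) \<and> (\<lambda>n. nrm A (x n - a)) \<longlonglongrightarrow> 0 \<and>
         ((\<lambda>(n, m). sesq_form A \<omega> (x n - x m) (x n - x m)) \<longlongrightarrow> 0) (sequentially \<times>\<^sub>F sequentially)}"

text \<open>If the zero functional is the only continuous representable one, this is \<open>UNIV\<close>, because
  the core is dense.\<close>

definition common_domain :: "'a::complex_vector quasi_alg \<Rightarrow> 'a set" where
  "common_domain A = (\<Inter>\<omega>\<in>cont_representable A. closure_domain A \<omega>)"

definition positive_cone :: "'a::complex_vector quasi_alg \<Rightarrow> 'a set" where
  "positive_cone A = norm_topology (nrm A) closure_of
     {\<Sum>k<n. adj A (x k) \<cdot>\<^bsub>A\<^esub> x k | (x :: nat \<Rightarrow> 'a) n. \<forall>k<n. x k \<in> core A}"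

definition sufficient :: "'a::complex_vector quasi_alg \<Rightarrow> bool" where
  "sufficient A \<longleftrightarrow> (\<forall>a\<in>positive_cone A. a \<noteq> 0 \<longrightarrow> (\<exists>\<omega>\<in>cont_representable A. 0 < \<omega> a))"

definition fully_representable :: "'a::complex_vector quasi_alg \<Rightarrow> bool" where
  "fully_representable A \<longleftrightarrow>
     normed_quasi_star_algebra A \<and> sufficient A \<and> common_domain A = UNIV"

definition condition_P :: "'a::complex_vector quasi_alg \<Rightarrow> bool" where
  "condition_P A \<longleftrightarrow>
     (\<forall>a. (\<forall>\<omega>\<in>cont_representable A. \<forall>x\<in>core A. 0 \<le> \<omega> (adj A x \<cdot>\<^bsub>A\<^esub> a \<cdot>\<^bsub>A\<^esub> x))
        \<longrightarrow> a \<in> positive_cone A)"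

section \<open>The tensor product of quasi *-algebras\<close>

text \<open>Since the scalars form a field, \<open>\<AA>\<^sub>0 \<otimes> \<BB>\<^sub>0\<close> embeds into \<open>\<AA> \<otimes> \<BB>\<close>; it is identified with
  its image.\<close>

definition tensor_core ::
    "'a::complex_vector quasi_alg \<Rightarrow> 'b::complex_vector quasi_alg \<Rightarrow> ('a, 'b) tensor set" where
  "tensor_core A B = complex_vector.span {x \<otimes> y | x y. x \<in> core A \<and> y \<in> core B}"

definition tensor_adj ::
    "'a::complex_vector quasi_alg \<Rightarrow> 'b::complex_vector quasi_alg \<Rightarrow> ('a, 'b) tensor \<Rightarrow> ('a, 'b) tensor"
  where "tensor_adj A B =
    (THE F. (\<forall>s t. F (s + t) = F s + F t) \<and> (\<forall>c t. F (c *\<^sub>C t) = cnj c *\<^sub>C F t) \<and>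
            (\<forall>a b. F (a \<otimes> b) = adj A a \<otimes> adj B b))"

text \<open>The product of \<open>s = (\<Sum>i. a\<^sub>i \<otimes> b\<^sub>i)\<close> and \<open>t = (\<Sum>j. x\<^sub>j \<otimes> y\<^sub>j)\<close> is \<open>\<Sum>i j. a\<^sub>i x\<^sub>j \<otimes> b\<^sub>i y\<^sub>j\<close>,
  provided that all the \<open>x\<^sub>j\<close>, \<open>y\<^sub>j\<close> or all the \<open>a\<^sub>i\<close>, \<open>b\<^sub>i\<close> lie in the cores.\<close>

definition tensor_mult ::
    "'a::complex_vector quasi_alg \<Rightarrow> 'b::complex_vector quasi_alg \<Rightarrow>
      ('a, 'b) tensor \<Rightarrow> ('a, 'b) tensor \<Rightarrow> ('a, 'b) tensor" where
  "tensor_mult A B s t =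
    (THE u. \<exists>us vs.
       s = (\<Sum>(a, b)\<leftarrow>us. a \<otimes> b) \<and> t = (\<Sum>(x, y)\<leftarrow>vs. x \<otimes> y) \<and>
       (set vs \<subseteq> core A \<times> core B \<or> set us \<subseteq> core A \<times> core B) \<and>
       u = (\<Sum>(a, b)\<leftarrow>us. \<Sum>(x, y)\<leftarrow>vs. (a \<cdot>\<^bsub>A\<^esub> x) \<otimes> (b \<cdot>\<^bsub>B\<^esub> y)))"

text \<open>Both operations are well defined.\<close>

lemma tensor_adj:
  assumes A: "quasi_star_algebra A" and B: "quasi_star_algebra B"
  shows tensor_adj_add: "tensor_adj A B (s + t) = tensor_adj A B s + tensor_adj A B t"
    and tensor_adj_scale: "tensor_adj A B (c *\<^sub>C t) = cnj c *\<^sub>C tensor_adj A B t"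
    and tensor_adj_pure: "tensor_adj A B (a \<otimes> b) = adj A a \<otimes> adj B b"
proof -
  interpret A: quasi_star_algebra A by (rule A)
  interpret B: quasi_star_algebra B by (rule B)
  interpret conj: vector_space "\<lambda>c (t :: ('a, 'b) tensor). cnj c *\<^sub>C t"
    by unfold_locales (simp_all add: scaleC_add_right scaleC_add_left scaleC_scaleC scaleC_one)
  have lin: "Vector_Spaces.linear scaleC (\<lambda>c t. cnj c *\<^sub>C t) F \<longleftrightarrow>
      (\<forall>s t. F (s + t) = F s + F t) \<and> (\<forall>c t. F (c *\<^sub>C t) = cnj c *\<^sub>C F t)"
    for F :: "'c::complex_vector \<Rightarrow> ('a, 'b) tensor"
    by (simp add: linear_iff_module_hom module_hom_iff
        complex_vector.vector_space_axioms conj.vector_space_axioms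
        complex_vector.module_axioms conj.module_axioms Vector_Spaces.linear_def)
  have "\<exists>!F. Vector_Spaces.linear scaleC (\<lambda>c t. cnj c *\<^sub>C t) F \<and>
      (\<forall>a b. F (a \<otimes> b) = adj A a \<otimes> adj B b)"
    by (rule tensor_universal_property, rule conj.vector_space_axioms)
      (simp_all add: lin A.adj_add B.adj_add A.adj_scale B.adj_scale
        tensor_add_left tensor_add_right tensor_scale_left tensor_scale_right)
  from theI'[OF this[unfolded lin], unfolded conj_assoc, folded tensor_adj_def]
  show "tensor_adj A B (s + t) = tensor_adj A B s + tensor_adj A B t"
    and "tensor_adj A B (c *\<^sub>C t) = cnj c *\<^sub>C tensor_adj A B t"
    and "tensor_adj A B (a \<otimes> b) = adj A a \<otimes> adj B b"
    by blast+
qed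

lemma linear_extension_exists:
  fixes f :: "'a::complex_vector \<Rightarrow> 'a"
  assumes S: "complex_vector.subspace S"
    and add: "\<And>x y. \<lbrakk>x \<in> S; y \<in> S\<rbrakk> \<Longrightarrow> f (x + y) = f x + f y"
    and scale: "\<And>c x. x \<in> S \<Longrightarrow> f (c *\<^sub>C x) = c *\<^sub>C f x"
  shows "\<exists>L. Vector_Spaces.linear scaleC scaleC L \<and> (\<forall>x\<in>S. L x = f x)"
proof -
  interpret pair: vector_space_pair "scaleC :: _ \<Rightarrow> 'a \<Rightarrow> 'a" "scaleC :: _ \<Rightarrow> 'a \<Rightarrow> 'a" ..
  obtain E where E: "E \<subseteq> S" "complex_vector.independent E" "S \<subseteq> complex_vector.span E"
    using complex_vector.maximal_independent_subset by metis
  define L where "L = pair.construct E f"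
  interpret L: Vector_Spaces.linear scaleC scaleC L
    unfolding L_def using E(2) by (rule pair.linear_construct)
  have f0: "f 0 = 0"
    using scale[of 0 0] complex_vector.subspace_0[OF S] by simp
  have "x \<in> S \<and> L x = f x" if "x \<in> complex_vector.span E" for x
    using that
  proof (induction rule: complex_vector.span_induct_alt)
    case base
    then show ?case using f0 complex_vector.subspace_0[OF S] by (simp add: L.zero)
  next
    case (step c x y)
    have "L x = f x"
      unfolding L_def using E(2) step(1) by (rule pair.construct_basis)
    then show ?case
      using step E(1) S
      by (auto simp: L.add L.scale add scale complex_vector.subspace_add complex_vector.subspace_scale
          subsetD)
  qed
  then show ?thesis
    using E(3) L.linear_axioms by (intro exI[of _ L]) blast
qed

lemma tensor_mult_eq:
  assumes A: "quasi_star_algebra A" and B: "quasi_star_algebra B"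
    and core: "set vs \<subseteq> core A \<times> core B \<or> set us \<subseteq> core A \<times> core B"
  shows "tensor_mult A B (\<Sum>(a, b)\<leftarrow>us. a \<otimes> b) (\<Sum>(x, y)\<leftarrow>vs. x \<otimes> y) =
    (\<Sum>(a, b)\<leftarrow>us. \<Sum>(x, y)\<leftarrow>vs. (a \<cdot>\<^bsub>A\<^esub> x) \<otimes> (b \<cdot>\<^bsub>B\<^esub> y))"
proof -
  interpret A: quasi_star_algebra A by (rule A)
  interpret B: quasi_star_algebra B by (rule B)
  let ?t = "\<lambda>us :: ('a \<times> 'b) list. \<Sum>(a, b)\<leftarrow>us. a \<otimes> b"
  let ?C = "core A \<times> core B"
  define M where "M us vs = (\<Sum>(a, b)\<leftarrow>us. \<Sum>(x, y)\<leftarrow>vs. (a \<cdot>\<^bsub>A\<^esub> x) \<otimes> (b \<cdot>\<^bsub>B\<^esub> y))" for us vs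
  define M1 where "M1 us v = (\<Sum>(a, b)\<leftarrow>us. (a \<cdot>\<^bsub>A\<^esub> fst v) \<otimes> (b \<cdot>\<^bsub>B\<^esub> snd v))" for us v
  define M2 where "M2 u vs = (\<Sum>(x, y)\<leftarrow>vs. (fst u \<cdot>\<^bsub>A\<^esub> x) \<otimes> (snd u \<cdot>\<^bsub>B\<^esub> y))" for u vs
  have M1: "M us vs = (\<Sum>v\<leftarrow>vs. M1 us v)" for us vs
    unfolding M_def M1_def
    by (induction us) (simp_all add: case_prod_beta sum_list_addf)
  have M2: "M us vs = (\<Sum>u\<leftarrow>us. M2 u vs)" for us vs
    unfolding M_def M2_def by (induction us) (simp_all add: case_prod_beta)
  have sum_map: "tensor_map f g (?t us) = (\<Sum>(a, b)\<leftarrow>us. f a \<otimes> g b)"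
    if f: "Vector_Spaces.linear scaleC scaleC f" and g: "Vector_Spaces.linear scaleC scaleC g" for f g us
  proof -
    interpret fg: Vector_Spaces.linear scaleC scaleC "tensor_map f g"
      using f g by (rule linear_tensor_map)
    show ?thesis
      by (induction us) (auto simp: fg.zero fg.add tensor_map_pure[OF f g])
  qed
  have R: "M us vs = M us' vs" if vs: "set vs \<subseteq> ?C" and eq: "?t us = ?t us'" for us us' vs
  proof -
    have "M1 us v = M1 us' v" if "v \<in> set vs" for v
    proof -
      have lin: "Vector_Spaces.linear scaleC scaleC (\<lambda>a. a \<cdot>\<^bsub>A\<^esub> fst v)"
        "Vector_Spaces.linear scaleC scaleC (\<lambda>b. b \<cdot>\<^bsub>B\<^esub> snd v)"
        by (rule A.right_mult_linear B.right_mult_linear, use vs that in auto)+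
      show ?thesis
        unfolding M1_def sum_map[OF lin, symmetric] eq ..
    qed
    then show ?thesis unfolding M1 by (simp cong: map_cong)
  qed
  have L: "M us vs = M us vs'" if us: "set us \<subseteq> ?C" and eq: "?t vs = ?t vs'" for us vs vs'
  proof -
    have "M2 u vs = M2 u vs'" if "u \<in> set us" for u
    proof -
      have lin: "Vector_Spaces.linear scaleC scaleC (\<lambda>x. fst u \<cdot>\<^bsub>A\<^esub> x)"
        "Vector_Spaces.linear scaleC scaleC (\<lambda>y. snd u \<cdot>\<^bsub>B\<^esub> y)"
        by (rule A.left_mult_linear B.left_mult_linear, use us that in auto)+
      show ?thesis
        unfolding M2_def sum_map[OF lin, symmetric] eq ..
    qed
    then show ?thesis unfolding M2 by (simp cong: map_cong)
  qed
  have R': "M us vs = M us vs'"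
    if vs: "set vs \<subseteq> ?C" and vs': "set vs' \<subseteq> ?C" and eq: "?t vs = ?t vs'" for us vs vs'
  proof -
    have "M2 u vs = M2 u vs'" for u
    proof -
      obtain f where f: "Vector_Spaces.linear scaleC scaleC f" "\<forall>x\<in>core A. f x = fst u \<cdot>\<^bsub>A\<^esub> x"
        using linear_extension_exists[OF A.core_subspace, of "\<lambda>x. fst u \<cdot>\<^bsub>A\<^esub> x"]
        by (auto simp: A.mult_add_core A.mult_scale_core)
      obtain g where g: "Vector_Spaces.linear scaleC scaleC g" "\<forall>y\<in>core B. g y = snd u \<cdot>\<^bsub>B\<^esub> y"
        using linear_extension_exists[OF B.core_subspace, of "\<lambda>y. snd u \<cdot>\<^bsub>B\<^esub> y"]
        by (auto simp: B.mult_add_core B.mult_scale_core)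
      have "M2 u ws = tensor_map f g (?t ws)" if "set ws \<subseteq> ?C" for ws
        unfolding M2_def sum_map[OF f(1) g(1)]
        using that f(2) g(2) by (intro arg_cong[of _ _ sum_list] map_cong) auto
      then show ?thesis using vs vs' eq by simp
    qed
    then show ?thesis unfolding M2 by simp
  qed
  have L': "M us vs = M us' vs"
    if us: "set us \<subseteq> ?C" and us': "set us' \<subseteq> ?C" and eq: "?t us = ?t us'" for us us' vs
  proof -
    have "M1 us v = M1 us' v" for v
    proof -
      obtain f where f: "Vector_Spaces.linear scaleC scaleC f" "\<forall>a\<in>core A. f a = a \<cdot>\<^bsub>A\<^esub> fst v"
        using linear_extension_exists[OF A.core_subspace, of "\<lambda>a. a \<cdot>\<^bsub>A\<^esub> fst v"]
        by (auto simp: A.core_add_mult A.core_scale_mult)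
      obtain g where g: "Vector_Spaces.linear scaleC scaleC g" "\<forall>b\<in>core B. g b = b \<cdot>\<^bsub>B\<^esub> snd v"
        using linear_extension_exists[OF B.core_subspace, of "\<lambda>b. b \<cdot>\<^bsub>B\<^esub> snd v"]
        by (auto simp: B.core_add_mult B.core_scale_mult)
      have "M1 ws v = tensor_map f g (?t ws)" if "set ws \<subseteq> ?C" for ws
        unfolding M1_def sum_map[OF f(1) g(1)]
        using that f(2) g(2) by (intro arg_cong[of _ _ sum_list] map_cong) auto
      then show ?thesis using us us' eq by simp
    qed
    then have "M1 us = M1 us'" by (rule ext)
    then show ?thesis unfolding M1 by simp
  qed
  have unique: "M us vs = M us' vs'"
    if "?t us = ?t us'" "?t vs = ?t vs'" "set vs \<subseteq> ?C \<or> set us \<subseteq> ?C" "set vs' \<subseteq> ?C \<or> set us' \<subseteq> ?C"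
    for us us' vs vs'
  proof -
    consider "set vs \<subseteq> ?C" "set vs' \<subseteq> ?C" | "set us \<subseteq> ?C" "set us' \<subseteq> ?C"
      | "set vs \<subseteq> ?C" "set us' \<subseteq> ?C" | "set us \<subseteq> ?C" "set vs' \<subseteq> ?C"
      using \<open>set vs \<subseteq> ?C \<or> _\<close> \<open>set vs' \<subseteq> ?C \<or> _\<close> by argo
    then show ?thesis
    proof cases
      case 1
      then show ?thesis using R[of vs us us'] R'[of vs vs' us'] that(1,2) by argo
    next
      case 2
      then show ?thesis using L[of us vs vs'] L'[of us us' vs'] that(1,2) by argo
    next
      case 3
      then show ?thesis using R[of vs us us'] L[of us' vs vs'] that(1,2) by argo
    next
      case 4
      then show ?thesis using L[of us vs vs'] R[of vs' us us'] that(1,2) by argo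
    qed
  qed
  show ?thesis
    unfolding tensor_mult_def M_def[symmetric]
  proof (rule the_equality)
    show "\<exists>us' vs'. ?t us = ?t us' \<and> ?t vs = ?t vs' \<and> (set vs' \<subseteq> ?C \<or> set us' \<subseteq> ?C) \<and> M us vs = M us' vs'"
      using core by (intro exI[of _ us] exI[of _ vs]) simp
  next
    fix u
    assume "\<exists>us' vs'. ?t us = ?t us' \<and> ?t vs = ?t vs' \<and> (set vs' \<subseteq> ?C \<or> set us' \<subseteq> ?C) \<and> u = M us' vs'"
    then show "u = M us vs"
      using unique[OF _ _ core] by metis
  qed
qed

definition tensor_quasi_alg ::
    "'a::complex_vector quasi_alg \<Rightarrow> 'b::complex_vector quasi_alg \<Rightarrow>
      (('a, 'b) tensor \<Rightarrow> real) \<Rightarrow> ('a, 'b) tensor quasi_alg" where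
  "tensor_quasi_alg A B n =
    \<lparr>core = tensor_core A B, mult = tensor_mult A B, adj = tensor_adj A B, nrm = n\<rparr>"

end

theory Submission
  imports Defs
begin

text \<open>A continuous representable functional of a barrelled normed quasi *-algebra gives a barrel
  \<open>{a. \<forall>x. |\<omega>(a\<^sup>* x)| \<le> \<omega>(x\<^sup>* x)\<^sup>1\<^sup>/\<^sup>2}\<close>, absorbing by (L.3), so \<open>\<omega>(x\<^sup>* x) \<le> C \<parallel>x\<parallel>\<^sup>2\<close> on the core
  and the closure of \<open>\<phi>\<^sub>\<omega>\<close> is everywhere defined. For sufficiency, condition (P) and sufficiency of
  the factors make the continuous representable functionals of \<open>\<AA>\<close> and of \<open>\<BB>\<close> separate points;
  hence so do the products \<open>\<omega> \<otimes> \<psi>\<close> on \<open>\<AA> \<otimes> \<BB>\<close>. These products are continuous because the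
  cross-norm is uniform, and representable by the Schur product theorem, applied to Gram matrices
  for (L.1) and to Gram matrices minus a rank one matrix for (L.3).\<close>

section \<open>Norms and their topology\<close>

text \<open>Outside the core the product a* a is undefined, so a cannot be added as a further vector
  to a Gram matrix and (L.3) is not a case of (L.1). It is therefore read as domination of the Gram
  matrix by a rank one matrix, a relation that survives entrywise products. Coefficients of a core
  tensor are absorbed into its factors, so the Schur product theorem is only used for the sum of all
  entries. Condition (P) tests the values \<omega>(x* a x), not \<omega>(a). The gap is bridged by
  noting that a \<mapsto> \<omega>(x* a x) is again continuous and representable. Likewise
  sufficiency asks for a strictly positive value while separation of points supplies only a nonzero
  one; both agree on the positive cone, where every continuous representable functional is
  nonnegative.\<close>

lemma linear_scaleC_iff:
  fixes f :: "'a::complex_vector \<Rightarrow> 'b::complex_vector"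
  shows "Vector_Spaces.linear scaleC scaleC f \<longleftrightarrow>
    (\<forall>x y. f (x + y) = f x + f y) \<and> (\<forall>c x. f (c *\<^sub>C x) = c *\<^sub>C f x)"
  by (simp add: Vector_Spaces.linear_iff complex_vector.vector_space_axioms)

lemma vector_space_complex: "vector_space ((*) :: complex \<Rightarrow> complex \<Rightarrow> complex)"
  by unfold_locales (simp_all add: algebra_simps)

lemma linear_functional_iff:
  fixes f :: "'a::complex_vector \<Rightarrow> complex"
  shows "Vector_Spaces.linear scaleC (*) f \<longleftrightarrow>
    (\<forall>x y. f (x + y) = f x + f y) \<and> (\<forall>c x. f (c *\<^sub>C x) = c * f x)"
  by (simp add: Vector_Spaces.linear_iff complex_vector.vector_space_axioms vector_space_complex)

lemma is_normD:
  assumes "is_norm N"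
  shows is_norm_nonneg: "0 \<le> N x"
    and is_norm_eq_0: "N x = 0 \<longleftrightarrow> x = 0"
    and is_norm_triangle: "N (x + y) \<le> N x + N y"
    and is_norm_scale: "N (c *\<^sub>C x) = cmod c * N x"
  using assms unfolding is_norm_def by blast+

lemma is_norm_minus:
  assumes "is_norm N"
  shows "N (- x) = N x"
  using is_norm_scale[OF assms, of "-1" x] by simp

lemma is_norm_minus_commute:
  assumes "is_norm N"
  shows "N (x - y) = N (y - x)"
  using is_norm_minus[OF assms, of "x - y"] by simp

lemma is_norm_triangle_diff:
  assumes "is_norm N"
  shows "N (x - z) \<le> N (x - y) + N (y - z)"
  using is_norm_triangle[OF assms, of "x - y" "y - z"] by simp

lemma Metric_space_norm:
  assumes "is_norm N"
  shows "Metric_space UNIV (\<lambda>x y. N (x - y))"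
  using assms
  by unfold_locales
    (auto simp: is_normD is_norm_minus_commute intro: is_norm_triangle_diff)

lemma in_norm_closure_iff:
  assumes "is_norm N"
  shows "a \<in> norm_topology N closure_of S \<longleftrightarrow> (\<forall>e>0. \<exists>x\<in>S. N (x - a) < e)"
proof -
  interpret Metric_space UNIV "\<lambda>x y. N (x - y)"
    by (rule Metric_space_norm[OF assms])
  show ?thesis
    unfolding norm_topology_def metric_closure_of
    by (simp add: is_norm_minus_commute[OF assms, of a])
qed

lemma zero_in_norm_interiorD:
  assumes "is_norm N" "0 \<in> norm_topology N interior_of U"
  obtains r where "r > 0" "\<And>x. N x < r \<Longrightarrow> x \<in> U"
proof -
  interpret Metric_space UNIV "\<lambda>x y. N (x - y)"
    by (rule Metric_space_norm[OF assms(1)])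
  show ?thesis
    using assms(2) that
    unfolding norm_topology_def in_interior_of_mball
    by (auto simp: is_norm_minus[OF assms(1)] mball_def subset_iff)
qed

text \<open>A common treatment of operators (\<open>d'\<close> from a norm) and functionals (\<open>d'\<close> from \<open>cmod\<close>).\<close>

lemma continuous_map_norm_iff:
  fixes f :: "'a::complex_vector \<Rightarrow> 'b::ab_group_add"
  assumes N: "is_norm N" and M: "Metric_space UNIV (\<lambda>x y. M (x - y))"
    and diff: "\<And>x y. f (x - y) = f x - f y"
    and scale: "\<And>r x. 0 < r \<Longrightarrow> M (f (complex_of_real r *\<^sub>C x)) = r * M (f x)"
  shows "continuous_map (norm_topology N) (Metric_space.mtopology UNIV (\<lambda>x y. M (x - y))) f
    \<longleftrightarrow> (\<exists>K. \<forall>x. M (f x) \<le> K * N x)" (is "?L \<longleftrightarrow> ?R")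
proof -
  interpret N: Metric_space UNIV "\<lambda>x y. N (x - y)"
    by (rule Metric_space_norm[OF N])
  interpret M: Metric_space UNIV "\<lambda>x y. M (x - y)" by (rule M)
  have f0: "f 0 = 0" using diff[of 0 0] by simp
  have cont: "?L \<longleftrightarrow> (\<forall>a. \<forall>e>0. \<exists>d>0. \<forall>x. N (a - x) < d \<longrightarrow> M (f a - f x) < e)"
    unfolding norm_topology_def N.metric_continuous_map[OF M] by simp
  show ?thesis
  proof
    assume ?L
    then obtain d where d: "d > 0" "\<And>x. N (0 - x) < d \<Longrightarrow> M (f 0 - f x) < 1"
      unfolding cont by (metis zero_less_one)
    have d': "M (f x) < 1" if "N x < d" for x
      using d(2)[of "- x"] that diff[of 0 x] diff[of 0 "- x"] by (simp add: f0)
    \<comment> \<open>A nonzero \<open>x\<close> rescaled to norm d / 2 lies in the ball where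
      \<open>M (f x) < 1\<close>; undoing the scaling gives the constant 2 / d.\<close>
    have "M (f x) \<le> (2 / d) * N x" for x
    proof (cases "x = 0")
      case True
      then show ?thesis using M.zero[of 0 0] is_norm_eq_0[OF N, of 0] by (simp add: f0)
    next
      case False
      then have pos: "N x > 0"
        using is_norm_nonneg[OF N, of x] is_norm_eq_0[OF N, of x] by linarith
      define r where "r = d / (2 * N x)"
      have r: "r > 0" using pos d(1) by (simp add: r_def)
      have "N (complex_of_real r *\<^sub>C x) < d"
        using pos d(1) r by (simp add: is_norm_scale[OF N]) (simp add: r_def)
      from d'[OF this] have "r * M (f x) < 1" by (simp add: scale[OF r])
      then show ?thesis using pos d(1) by (simp add: r_def field_simps)
    qed
    then show ?R by blast
  next
    assume ?R
    then obtain K where K: "\<And>x. M (f x) \<le> K * N x" by blast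
    \<comment> \<open>\<open>K\<close> may be zero or negative; \<open>\<bar>K\<bar> + 1\<close> is
      a constant by which \<open>e\<close> can be divided.\<close>
    have K': "M (f x) \<le> (\<bar>K\<bar> + 1) * N x" for x
      using K[of x] mult_right_mono[of K "\<bar>K\<bar> + 1" "N x"] is_norm_nonneg[OF N, of x] by linarith
    show ?L
      unfolding cont
    proof (intro allI impI)
      fix a and e :: real assume e: "e > 0"
      show "\<exists>d>0. \<forall>x. N (a - x) < d \<longrightarrow> M (f a - f x) < e"
      proof (intro exI[of _ "e / (\<bar>K\<bar> + 1)"] conjI allI impI)
        show "e / (\<bar>K\<bar> + 1) > 0" using e by (simp add: pos_add_strict)
        fix x assume "N (a - x) < e / (\<bar>K\<bar> + 1)"
        then have "(\<bar>K\<bar> + 1) * N (a - x) < e" by (simp add: field_simps)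
        then show "M (f a - f x) < e" using K'[of "a - x"] by (simp add: diff)
      qed
    qed
  qed
qed

lemma continuous_operator_iff:
  fixes f :: "'a::complex_vector \<Rightarrow> 'a"
  assumes N: "is_norm N" and f: "Vector_Spaces.linear scaleC scaleC f"
  shows "continuous_map (norm_topology N) (norm_topology N) f \<longleftrightarrow> (\<exists>K. \<forall>x. N (f x) \<le> K * N x)"
proof -
  interpret f: Vector_Spaces.linear scaleC scaleC f by (rule f)
  show ?thesis
    \<comment> \<open>Only the topology of the codomain is unfolded: the general lemma keeps
      \<open>norm_topology N\<close> on the domain side.\<close>
    unfolding norm_topology_def[of N, THEN arg_cong[where f = "\<lambda>T. continuous_map _ T f"]]
    by (rule continuous_map_norm_iff[OF N Metric_space_norm[OF N]])
      (simp_all add: f.diff f.scale is_norm_scale[OF N])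
qed

lemma continuous_functional_iff:
  fixes f :: "'a::complex_vector \<Rightarrow> complex"
  assumes N: "is_norm N" and f: "Vector_Spaces.linear scaleC (*) f"
  shows "continuous_map (norm_topology N) euclidean f \<longleftrightarrow> (\<exists>K. \<forall>x. cmod (f x) \<le> K * N x)"
proof -
  interpret f: Vector_Spaces.linear scaleC "(*)" f by (rule f)
  have *: "(\<lambda>x y. cmod (x - y)) = dist" by (simp add: dist_norm fun_eq_iff)
  have "Metric_space UNIV (\<lambda>x y. cmod (x - y))"
    unfolding * by (rule Met_TC.Metric_space_axioms)
  from continuous_map_norm_iff[OF N this, of f] show ?thesis
    by (simp add: f.diff f.scale norm_mult *)
qed

section \<open>Representable functionals\<close>

context quasi_star_algebra
begin

text \<open>The axioms cover the cases where the arbitrary factor stands on the left or in the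
  middle; the involution turns the first of them into the remaining case.\<close>

lemma mult_assoc_left:
  assumes "x \<in> core A" "y \<in> core A"
  shows "(x \<cdot> y) \<cdot> a = x \<cdot> (y \<cdot> a)"
proof -
  have "adj A (x \<cdot> (y \<cdot> a)) = adj A ((x \<cdot> y) \<cdot> a)"
    using assms by (simp add: adj_mult_left core_adj core_mult mult_assoc_right adj_mult_right)
  then show ?thesis by (metis adj_adj)
qed

lemma adj_sum: "adj A (sum f I) = (\<Sum>i\<in>I. adj A (f i))"
proof (cases "finite I")
  case True
  have "adj A 0 = 0" using adj_add[of 0 0] by simp
  with True show ?thesis by (induction I) (simp_all add: adj_add)
next
  case False
  then show ?thesis using adj_add[of 0 0] by simp
qed

lemma core_sum: "(\<And>i. i \<in> I \<Longrightarrow> f i \<in> core A) \<Longrightarrow> sum f I \<in> core A"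
  by (rule complex_vector.subspace_sum[OF core_subspace])

lemma core_scale: "x \<in> core A \<Longrightarrow> c *\<^sub>C x \<in> core A"
  by (rule complex_vector.subspace_scale[OF core_subspace])

lemma core_diff: "\<lbrakk>x \<in> core A; y \<in> core A\<rbrakk> \<Longrightarrow> x - y \<in> core A"
  by (rule complex_vector.subspace_diff[OF core_subspace])

end

lemma representableD:
  assumes "representable A \<omega>"
  shows representable_linear: "Vector_Spaces.linear scaleC (*) \<omega>"
    and representable_pos: "x \<in> core A \<Longrightarrow> 0 \<le> \<omega> (adj A x \<cdot>\<^bsub>A\<^esub> x)"
    and representable_herm: "\<lbrakk>x \<in> core A; y \<in> core A\<rbrakk> \<Longrightarrow>
      \<omega> (adj A y \<cdot>\<^bsub>A\<^esub> adj A a \<cdot>\<^bsub>A\<^esub> x) = cnj (\<omega> (adj A x \<cdot>\<^bsub>A\<^esub> a \<cdot>\<^bsub>A\<^esub> y))"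
    and representable_bound: "\<exists>\<gamma>>0. \<forall>x\<in>core A.
        cmod (\<omega> (adj A a \<cdot>\<^bsub>A\<^esub> x)) \<le> \<gamma> * sqrt (Re (\<omega> (adj A x \<cdot>\<^bsub>A\<^esub> x)))"
  using assms unfolding representable_def by blast+

section \<open>Continuous representable functionals: closures of their forms, separation,
  positivity\<close>

context normed_quasi_star_algebra
begin

lemma right_mult_bounded:
  assumes "x \<in> core A"
  shows "\<exists>K. \<forall>a. nrm A (a \<cdot> x) \<le> K * nrm A a"
  using right_mult_continuous[OF assms]
  unfolding continuous_operator_iff[OF is_norm right_mult_linear[OF assms]] .

text \<open>Left multiplication by x is right multiplication by x* conjugated with the isometric
  involution.\<close>

lemma left_mult_bounded:
  assumes "x \<in> core A"
  shows "\<exists>K. \<forall>a. nrm A (x \<cdot> a) \<le> K * nrm A a"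
proof -
  obtain K where K: "nrm A (a \<cdot> adj A x) \<le> K * nrm A a" for a
    using right_mult_bounded[OF core_adj[OF assms]] by blast
  have "nrm A (x \<cdot> a) \<le> K * nrm A a" for a
    using K[of "adj A a"] adj_mult_left[OF assms, of a] nrm_adj by metis
  then show ?thesis by blast
qed

text \<open>This is (L.2) at the unit, which is its own adjoint.\<close>

lemma sesq_hermitian:
  assumes \<omega>: "representable A \<omega>" and "x \<in> core A" "y \<in> core A"
  shows "\<omega> (adj A y \<cdot> x) = cnj (\<omega> (adj A x \<cdot> y))"
proof -
  obtain e where e: "e \<in> core A" "\<And>a. a \<cdot> e = a" "\<And>a. e \<cdot> a = a"
    using unital by blast
  have "adj A e = e"
    using adj_mult_left[OF e(1), of "adj A e"] e by (metis adj_adj)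
  then show ?thesis
    using representable_herm[OF \<omega> assms(2,3), of e] e by simp
qed

text \<open>The set of all \<open>a\<close> for which (L.3) holds with \<open>\<gamma>\<^sub>a = 1\<close> is a barrel. Since it contains a
  ball, the norm dominates the seminorm of the positive functional on the core.\<close>

lemma barrelled_sesq_bound:
  assumes barrelled: "barrelled (nrm A)" and \<omega>: "\<omega> \<in> cont_representable A"
  shows "\<exists>C. \<forall>x\<in>core A. Re (\<omega> (adj A x \<cdot> x)) \<le> C * (nrm A x)\<^sup>2"
proof -
  have rep: "representable A \<omega>" and cont: "continuous_map (norm_topology (nrm A)) euclidean \<omega>"
    using \<omega> by (auto simp: cont_representable_def)
  note N = is_norm
  interpret \<omega>: Vector_Spaces.linear scaleC "(*)" \<omega> by (rule representable_linear[OF rep])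
  interpret M: Metric_space UNIV "\<lambda>x y. nrm A (x - y)" by (rule Metric_space_norm[OF N])
  obtain K where K: "cmod (\<omega> a) \<le> K * nrm A a" for a
    using cont unfolding continuous_functional_iff[OF N \<omega>.linear_axioms] by blast
  define s where "s x = sqrt (Re (\<omega> (adj A x \<cdot> x)))" for x
  define p where "p x a = cmod (\<omega> (adj A a \<cdot> x))" for x a
  define U where "U = {a. \<forall>x\<in>core A. p x a \<le> s x}"
  have s_nonneg: "0 \<le> s x" if "x \<in> core A" for x
    using representable_pos[OF rep that] by (simp add: s_def less_eq_complex_def)
  \<comment> \<open>The functional inside \<open>p x\<close> is conjugate-linear in \<open>a\<close>
    because of the involution; the modulus absorbs the conjugation, so \<open>p x\<close> is a
    seminorm.\<close>
  have p_add: "p x (a + b) \<le> p x a + p x b" and p_scale: "p x (c *\<^sub>C a) = cmod c * p x a"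
    if "x \<in> core A" for x a b c
  proof -
    interpret R: Vector_Spaces.linear scaleC scaleC "\<lambda>a. a \<cdot> x" by (rule right_mult_linear[OF that])
    show "p x (a + b) \<le> p x a + p x b"
      by (simp add: p_def adj_add R.add \<omega>.add norm_triangle_ineq)
    show "p x (c *\<^sub>C a) = cmod c * p x a"
      by (simp add: p_def adj_scale R.scale \<omega>.scale norm_mult)
  qed
  have p_bound: "\<exists>L. \<forall>a. p x a \<le> L * nrm A a" if x: "x \<in> core A" for x
  proof -
    obtain L where L: "nrm A (a \<cdot> x) \<le> L * nrm A a" for a
      using right_mult_bounded[OF x] by blast
    have "p x a \<le> (\<bar>K\<bar> * L) * nrm A a" for a
    proof -
      have "p x a \<le> K * nrm A (adj A a \<cdot> x)" unfolding p_def by (rule K)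
      also have "\<dots> \<le> \<bar>K\<bar> * nrm A (adj A a \<cdot> x)"
        using is_norm_nonneg[OF N] by (intro mult_right_mono) auto
      also have "\<dots> \<le> \<bar>K\<bar> * (L * nrm A a)"
        using L[of "adj A a"] by (intro mult_left_mono) (auto simp: nrm_adj)
      finally show ?thesis by (simp add: mult.assoc)
    qed
    then show ?thesis by blast
  qed
  have "barrel (nrm A) U"
    unfolding barrel_def
  proof (intro conjI allI impI)
    \<comment> \<open>\<open>U\<close> is an intersection of sublevel sets of the seminorms
      \<open>p x\<close>. Each of them is norm continuous, so a strict violation at \<open>a\<close>
      persists on a ball.\<close>
    show "closedin (norm_topology (nrm A)) U"
      unfolding norm_topology_def M.closedin_metric
    proof (intro conjI allI impI)
      fix a assume "a \<in> UNIV - U"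
      then obtain x where x: "x \<in> core A" "p x a > s x" by (auto simp: U_def not_le)
      obtain L where L: "p x b \<le> L * nrm A b" for b using p_bound[OF x(1)] by blast
      define r where "r = (p x a - s x) / (\<bar>L\<bar> + 1)"
      have r: "r > 0" using x(2) by (simp add: r_def pos_add_strict)
      have "b \<notin> U" if "nrm A (a - b) < r" for b
      proof -
        have "p x (a - b) \<le> L * nrm A (a - b)" by (rule L)
        also have "\<dots> \<le> (\<bar>L\<bar> + 1) * nrm A (a - b)"
          using is_norm_nonneg[OF N] by (intro mult_right_mono) auto
        also have "\<dots> < p x a - s x"
          using that by (simp add: r_def field_simps)
        finally have "p x (a - b) < p x a - s x" .
        then have "p x b > s x" using p_add[OF x(1), of b "a - b"] by simp
        then show ?thesis using x(1) by (auto simp: U_def not_le)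
      qed
      then show "\<exists>r>0. disjnt U (M.mball a r)"
        using r by (intro exI[of _ r]) (auto simp: disjnt_def)
    qed auto
    show "convex U"
    proof (rule convexI)
      fix a b and u v :: real
      assume ab: "a \<in> U" "b \<in> U" and uv: "0 \<le> u" "0 \<le> v" "u + v = 1"
      show "u *\<^sub>R a + v *\<^sub>R b \<in> U"
        unfolding U_def scaleR_scaleC
      proof safe
        fix x assume x: "x \<in> core A"
        have "p x (complex_of_real u *\<^sub>C a + complex_of_real v *\<^sub>C b) \<le> u * p x a + v * p x b"
          using p_add[OF x, of "complex_of_real u *\<^sub>C a" "complex_of_real v *\<^sub>C b"] uv
          by (simp add: p_scale[OF x])
        also have "\<dots> \<le> u * s x + v * s x"
          using ab x uv by (intro add_mono mult_left_mono) (auto simp: U_def)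
        also have "\<dots> = s x" using uv(3) by (metis distrib_right mult_1)
        finally show "p x (complex_of_real u *\<^sub>C a + complex_of_real v *\<^sub>C b) \<le> s x" .
      qed
    qed
  next
    fix c a assume c: "cmod c \<le> 1" and a: "a \<in> U"
    show "c *\<^sub>C a \<in> U"
      unfolding U_def
    proof safe
      fix x assume x: "x \<in> core A"
      have "cmod c * p x a \<le> 1 * s x"
        using c a x s_nonneg[OF x] by (intro mult_mono) (auto simp: U_def p_def)
      then show "p x (c *\<^sub>C a) \<le> s x" by (simp add: p_scale[OF x])
    qed
  next
    fix a
    obtain g where g: "g > 0" "\<And>x. x \<in> core A \<Longrightarrow> p x a \<le> g * s x"
      using representable_bound[OF rep, of a] unfolding p_def s_def by blast
    have "c *\<^sub>C a \<in> U" if "cmod c \<le> 1 / g" for c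
      unfolding U_def
    proof safe
      fix x assume x: "x \<in> core A"
      have "cmod c * p x a \<le> (1 / g) * (g * s x)"
        using that g(2)[OF x] s_nonneg[OF x] g(1) by (intro mult_mono) (auto simp: p_def)
      then show "p x (c *\<^sub>C a) \<le> s x" using g(1) by (simp add: p_scale[OF x])
    qed
    then show "\<exists>r>0. \<forall>c. cmod c \<le> r \<longrightarrow> c *\<^sub>C a \<in> U"
      using g(1) by (intro exI[of _ "1 / g"]) auto
  qed
  then have "0 \<in> norm_topology (nrm A) interior_of U"
    using barrelled unfolding barrelled_def by blast
  then obtain r where r: "r > 0" "\<And>a. nrm A a < r \<Longrightarrow> a \<in> U"
    by (rule zero_in_norm_interiorD[OF N]) blast
  \<comment> \<open>A multiple of \<open>x\<close> of norm r / 2 lies in \<open>U\<close>. Testing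
    it against \<open>x\<close> itself gives \<open>t * (s x)\<^sup>2 \<le> s x\<close> with
    \<open>t = r / (2 * nrm A x)\<close>, hence \<open>s x \<le> 2 / r * nrm A x\<close>.\<close>
  have "Re (\<omega> (adj A x \<cdot> x)) \<le> (2 / r)\<^sup>2 * (nrm A x)\<^sup>2" if x: "x \<in> core A" for x
  proof (cases "x = 0")
    case True
    interpret R: Vector_Spaces.linear scaleC scaleC "\<lambda>a. a \<cdot> x" by (rule right_mult_linear[OF x])
    show ?thesis using adj_add[of 0 0] R.zero by (simp add: True \<omega>.zero)
  next
    case False
    then have pos: "nrm A x > 0"
      using is_norm_nonneg[OF N, of x] is_norm_eq_0[OF N, of x] by linarith
    define t where "t = r / (2 * nrm A x)"
    have t: "t > 0" using pos r(1) by (simp add: t_def)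
    have "nrm A (complex_of_real t *\<^sub>C x) < r"
      using pos r(1) t by (simp add: is_norm_scale[OF N]) (simp add: t_def)
    from r(2)[OF this] have "p x (complex_of_real t *\<^sub>C x) \<le> s x" using x by (simp add: U_def)
    then have *: "t * p x x \<le> s x" using t by (simp add: p_scale[OF x])
    have "p x x = (s x)\<^sup>2"
      using representable_pos[OF rep x]
      by (simp add: p_def s_def less_eq_complex_def cmod_eq_Re)
    then have "t * s x * s x \<le> 1 * s x" using * by (simp add: power2_eq_square mult.assoc)
    then have "t * s x \<le> 1"
      using s_nonneg[OF x] by (cases "s x = 0") (auto simp: mult_le_cancel_right)
    then have "s x \<le> 2 / r * nrm A x" using pos r(1) by (simp add: t_def field_simps)
    then have "(s x)\<^sup>2 \<le> (2 / r * nrm A x)\<^sup>2"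
      using s_nonneg[OF x] by (intro power_mono) auto
    moreover have "(s x)\<^sup>2 = Re (\<omega> (adj A x \<cdot> x))"
      using representable_pos[OF rep x] by (simp add: s_def less_eq_complex_def)
    ultimately show ?thesis by (simp add: power_mult_distrib power_divide)
  qed
  then show ?thesis by blast
qed

text \<open>Since the squared norm dominates the form on the core, every sequence of the core that
  converges in norm is Cauchy for the form; density provides one with limit
  \<open>a\<close>.\<close>

lemma barrelled_common_domain:
  assumes "barrelled (nrm A)"
  shows "common_domain A = UNIV"
proof -
  have "a \<in> closure_domain A \<omega>" if \<omega>: "\<omega> \<in> cont_representable A" for \<omega> a
  proof -
    have rep: "representable A \<omega>" using \<omega> by (simp add: cont_representable_def)
    obtain C where C: "Re (\<omega> (adj A x \<cdot> x)) \<le> C * (nrm A x)\<^sup>2" if "x \<in> core A" for x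
      using barrelled_sesq_bound[OF assms \<omega>] by blast
    have "\<exists>x\<in>core A. nrm A (x - a) < 1 / real (Suc k)" for k
      using core_dense in_norm_closure_iff[OF is_norm, of a "core A"] by simp
    then obtain x where x: "\<And>k. x k \<in> core A" "\<And>k. nrm A (x k - a) < 1 / real (Suc k)"
      by metis
    have conv: "(\<lambda>k. nrm A (x k - a)) \<longlonglongrightarrow> 0"
    proof (rule tendsto_sandwich[where f = "\<lambda>_. 0" and h = "\<lambda>k. 1 / real (Suc k)"])
      show "(\<lambda>k. 1 / real (Suc k)) \<longlonglongrightarrow> 0" by (rule lim_1_over_n[THEN LIMSEQ_Suc])
      show "\<forall>\<^sub>F k in sequentially. 0 \<le> nrm A (x k - a)"
        using is_norm_nonneg[OF is_norm] by simp
      show "\<forall>\<^sub>F k in sequentially. nrm A (x k - a) \<le> 1 / real (Suc k)"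
        using x(2) by (simp add: less_imp_le)
    qed simp
    have "((\<lambda>(n, m). sesq_form A \<omega> (x n - x m) (x n - x m)) \<longlongrightarrow> 0) (sequentially \<times>\<^sub>F sequentially)"
    proof (rule Lim_null_comparison)
      \<comment> \<open>The difference \<open>x n - x m\<close> is split at \<open>a\<close>, so
        that the bound tends to 0 in both indices jointly.\<close>
      show "((\<lambda>nm. \<bar>C\<bar> * (nrm A (x (fst nm) - a) + nrm A (x (snd nm) - a))\<^sup>2) \<longlongrightarrow> 0)
          (sequentially \<times>\<^sub>F sequentially)"
        by (rule tendsto_eq_intros refl filterlim_compose[OF conv filterlim_fst]
            filterlim_compose[OF conv filterlim_snd])+ simp
      show "\<forall>\<^sub>F nm in sequentially \<times>\<^sub>F sequentially.
          cmod (case nm of (n, m) \<Rightarrow> sesq_form A \<omega> (x n - x m) (x n - x m))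
          \<le> \<bar>C\<bar> * (nrm A (x (fst nm) - a) + nrm A (x (snd nm) - a))\<^sup>2"
      proof (rule always_eventually, safe)
        fix n m
        let ?z = "x n - x m"
        have z: "?z \<in> core A" using x(1) by (simp add: core_diff)
        have "nrm A ?z \<le> nrm A (x n - a) + nrm A (x m - a)"
          using is_norm_triangle_diff[OF is_norm, of "x n" "x m" a]
          by (simp add: is_norm_minus_commute[OF is_norm, of a])
        then have "\<bar>C\<bar> * (nrm A ?z)\<^sup>2 \<le> \<bar>C\<bar> * (nrm A (x n - a) + nrm A (x m - a))\<^sup>2"
          by (intro mult_left_mono power_mono) (simp_all add: is_norm_nonneg[OF is_norm])
        moreover have "C * (nrm A ?z)\<^sup>2 \<le> \<bar>C\<bar> * (nrm A ?z)\<^sup>2"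
          by (intro mult_right_mono) simp_all
        moreover have "cmod (\<omega> (adj A ?z \<cdot> ?z)) = Re (\<omega> (adj A ?z \<cdot> ?z))"
          using representable_pos[OF rep z] by (simp add: less_eq_complex_def cmod_eq_Re)
        ultimately show "cmod (sesq_form A \<omega> ?z ?z)
            \<le> \<bar>C\<bar> * (nrm A (x (fst (n, m)) - a) + nrm A (x (snd (n, m)) - a))\<^sup>2"
          using C[OF z] by (simp add: sesq_form_def)
      qed
    qed
    then show ?thesis using x(1) conv unfolding closure_domain_def by blast
  qed
  then show ?thesis unfolding common_domain_def by blast
qed

text \<open>From x* (a* y) x = (a x)* (y x), each condition for the new functional is the same
  condition for \<open>\<omega>\<close> at \<open>y \<cdot> x\<close> and, in (L.3), at
  \<open>a \<cdot> x\<close>. It lets the hypothesis of condition (P) be checked by evaluating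
  functionals at \<open>a\<close> alone.\<close>

lemma cont_representable_twist:
  assumes \<omega>: "\<omega> \<in> cont_representable A" and x: "x \<in> core A"
  shows "(\<lambda>a. \<omega> (adj A x \<cdot> a \<cdot> x)) \<in> cont_representable A"
proof -
  have rep: "representable A \<omega>" and cont: "continuous_map (norm_topology (nrm A)) euclidean \<omega>"
    using \<omega> by (auto simp: cont_representable_def)
  note xs = core_adj[OF x]
  interpret \<omega>: Vector_Spaces.linear scaleC "(*)" \<omega> by (rule representable_linear[OF rep])
  interpret R: Vector_Spaces.linear scaleC scaleC "\<lambda>a. a \<cdot> x" by (rule right_mult_linear[OF x])
  interpret L: Vector_Spaces.linear scaleC scaleC "\<lambda>a. adj A x \<cdot> a" by (rule left_mult_linear[OF xs])
  have lin: "Vector_Spaces.linear scaleC (*) (\<lambda>a. \<omega> (adj A x \<cdot> a \<cdot> x))"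
    by (simp add: linear_functional_iff L.add L.scale R.add R.scale \<omega>.add \<omega>.scale)
  have move: "adj A x \<cdot> (adj A a \<cdot> y) \<cdot> x = adj A (a \<cdot> x) \<cdot> (y \<cdot> x)" if "y \<in> core A" for a y
    using that x by (simp add: adj_mult_right mult_assoc_right mult_assoc_mid core_adj)
  have move2: "adj A x \<cdot> (adj A y \<cdot> a \<cdot> z) \<cdot> x = adj A (y \<cdot> x) \<cdot> a \<cdot> (z \<cdot> x)"
    if "y \<in> core A" "z \<in> core A" for a y z
    using that x by (simp add: adj_mult_right mult_assoc_right mult_assoc_mid mult_assoc_left
        core_adj core_mult)
  have "representable A (\<lambda>a. \<omega> (adj A x \<cdot> a \<cdot> x))"
    unfolding representable_def
  proof (intro conjI ballI allI)
    show "Vector_Spaces.linear scaleC (*) (\<lambda>a. \<omega> (adj A x \<cdot> a \<cdot> x))" by (rule lin)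
    show "0 \<le> \<omega> (adj A x \<cdot> (adj A y \<cdot> y) \<cdot> x)" if "y \<in> core A" for y
      using representable_pos[OF rep, of "y \<cdot> x"] that x by (simp add: move core_mult)
    show "\<omega> (adj A x \<cdot> (adj A z \<cdot> adj A a \<cdot> y) \<cdot> x) = cnj (\<omega> (adj A x \<cdot> (adj A y \<cdot> a \<cdot> z) \<cdot> x))"
      if "y \<in> core A" "z \<in> core A" for a y z
      using representable_herm[OF rep, of "y \<cdot> x" "z \<cdot> x"] that x by (simp add: move2 core_mult)
    show "\<exists>\<gamma>>0. \<forall>y\<in>core A. cmod (\<omega> (adj A x \<cdot> (adj A a \<cdot> y) \<cdot> x))
        \<le> \<gamma> * sqrt (Re (\<omega> (adj A x \<cdot> (adj A y \<cdot> y) \<cdot> x)))" for a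
      using representable_bound[OF rep, of "a \<cdot> x"] x core_mult by (auto simp: move)
  qed
  moreover have "continuous_map (norm_topology (nrm A)) euclidean (\<lambda>a. \<omega> (adj A x \<cdot> a \<cdot> x))"
  proof -
    have "continuous_map (norm_topology (nrm A)) (norm_topology (nrm A)) (\<lambda>a. adj A x \<cdot> a)"
      using left_mult_bounded[OF xs] continuous_operator_iff[OF is_norm L.linear_axioms] by blast
    from continuous_map_compose[OF continuous_map_compose[OF this right_mult_continuous[OF x]] cont]
    show ?thesis by (simp add: o_def)
  qed
  ultimately show ?thesis by (simp add: cont_representable_def)
qed

text \<open>By condition (P), an element at which all functionals vanish is positive.\<close>

lemma cont_representable_separating:
  assumes "sufficient A" "condition_P A" and zero: "\<And>\<omega>. \<omega> \<in> cont_representable A \<Longrightarrow> \<omega> a = 0"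
  shows "a = 0"
proof (rule ccontr)
  assume "a \<noteq> 0"
  have "\<omega> (adj A x \<cdot> a \<cdot> x) = 0" if "\<omega> \<in> cont_representable A" "x \<in> core A" for \<omega> x
    using zero[OF cont_representable_twist[OF that]] .
  then have "a \<in> positive_cone A"
    using assms(2) unfolding condition_P_def by (metis order_refl)
  then obtain \<omega> where "\<omega> \<in> cont_representable A" "0 < \<omega> a"
    using assms(1) \<open>a \<noteq> 0\<close> unfolding sufficient_def by blast
  then show False using zero[of \<omega>] by simp
qed

text \<open>(L.1) settles the sums of elements x* x, and the closed half-line of nonnegative complex
  numbers lets continuity carry this to their closure. On the cone, nonvanishing thus means strict
  positivity.\<close>

lemma cont_representable_nonneg:
  assumes \<omega>: "\<omega> \<in> cont_representable A" and a: "a \<in> positive_cone A"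
  shows "0 \<le> \<omega> a"
proof -
  have rep: "representable A \<omega>" and cont: "continuous_map (norm_topology (nrm A)) euclidean \<omega>"
    using \<omega> by (auto simp: cont_representable_def)
  interpret \<omega>: Vector_Spaces.linear scaleC "(*)" \<omega> by (rule representable_linear[OF rep])
  let ?S = "{\<Sum>k<n. adj A (x k) \<cdot> x k | (x :: nat \<Rightarrow> 'a) n. \<forall>k<n. x k \<in> core A}"
  have "closed {z::complex. 0 \<le> z}"
    unfolding less_eq_complex_def
    by (auto intro!: closed_Collect_conj closed_Collect_le closed_Collect_eq continuous_intros)
  moreover have "\<omega> ` ?S \<subseteq> {z. 0 \<le> z}"
    by (auto simp: \<omega>.sum intro!: sum_nonneg representable_pos[OF rep])
  ultimately have "euclidean closure_of (\<omega> ` ?S) \<subseteq> {z. 0 \<le> z}"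
    by (intro closure_of_minimal) simp_all
  then show ?thesis
    using continuous_map_image_closure_subset[OF cont, of ?S] a
    unfolding positive_cone_def by blast
qed

end

section \<open>The normed quasi *-algebra \<open>A \<otimes> B\<close>\<close>

lemma tensor_zero_left [simp]: "0 \<otimes> b = 0"
  using tensor_scale_left[of 0 0 b] by simp

lemma tensor_zero_right [simp]: "a \<otimes> 0 = 0"
  using tensor_scale_right[of a 0 0] by simp

lemma tensor_diff_left: "(a - a') \<otimes> b = a \<otimes> b - a' \<otimes> b"
  using tensor_add_left[of "a - a'" a' b] by simp

lemma tensor_diff_right: "a \<otimes> (b - b') = a \<otimes> b - a \<otimes> b'"
  using tensor_add_right[of a "b - b'" b'] by simp

lemma tensor_sum_right: "a \<otimes> sum f I = (\<Sum>i\<in>I. a \<otimes> f i)"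
  by (induction I rule: infinite_finite_induct) (simp_all add: tensor_add_right)

lemma tensor_core_pure: "\<lbrakk>x \<in> core A; y \<in> core B\<rbrakk> \<Longrightarrow> x \<otimes> y \<in> tensor_core A B"
  unfolding tensor_core_def by (rule complex_vector.span_base) blast

lemma tensor_core_add: "\<lbrakk>s \<in> tensor_core A B; t \<in> tensor_core A B\<rbrakk> \<Longrightarrow> s + t \<in> tensor_core A B"
  unfolding tensor_core_def by (rule complex_vector.span_add)

lemma tensor_core_scale: "t \<in> tensor_core A B \<Longrightarrow> c *\<^sub>C t \<in> tensor_core A B"
  unfolding tensor_core_def by (rule complex_vector.span_scale)

lemma tensor_core_zero [simp]: "0 \<in> tensor_core A B"
  unfolding tensor_core_def by (rule complex_vector.span_zero)

text \<open>The coefficients of a linear combination are absorbed into the first factors, which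
  remain in the subspace \<open>core A\<close>.\<close>

lemma tensor_core_list:
  assumes A: "complex_vector.subspace (core A)" and t: "t \<in> tensor_core A B"
  shows "\<exists>us. t = (\<Sum>(a, b)\<leftarrow>us. a \<otimes> b) \<and> set us \<subseteq> core A \<times> core B"
  using t unfolding tensor_core_def
proof (induction rule: complex_vector.span_induct_alt)
  case base
  then show ?case by (intro exI[of _ "[]"]) simp
next
  case (step c p q)
  then obtain x y us where "p = x \<otimes> y" "x \<in> core A" "y \<in> core B"
    "q = (\<Sum>(a, b)\<leftarrow>us. a \<otimes> b)" "set us \<subseteq> core A \<times> core B" by blast
  then show ?case
    using complex_vector.subspace_scale[OF A]
    by (intro exI[of _ "(c *\<^sub>C x, y) # us"]) (simp add: tensor_scale_left)
qed

lemma tensor_core_induct [consumes 2, case_names zero pure add]: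
  assumes "complex_vector.subspace (core A)" and "t \<in> tensor_core A B"
    and zero: "P 0"
    and pure: "\<And>x y. \<lbrakk>x \<in> core A; y \<in> core B\<rbrakk> \<Longrightarrow> P (x \<otimes> y)"
    and add: "\<And>s t. \<lbrakk>s \<in> tensor_core A B; t \<in> tensor_core A B; P s; P t\<rbrakk> \<Longrightarrow> P (s + t)"
  shows "P t"
proof -
  have "(\<Sum>(a, b)\<leftarrow>us. a \<otimes> b) \<in> tensor_core A B \<and> P (\<Sum>(a, b)\<leftarrow>us. a \<otimes> b)"
    if "set us \<subseteq> core A \<times> core B" for us
    using that by (induction us) (auto simp: zero intro!: add pure tensor_core_add tensor_core_pure)
  then show ?thesis using tensor_core_list[OF assms(1,2)] by blast
qed

text \<open>A representing list that lies in the cores whenever possible; with such lists both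
  alternatives in the hypothesis of \<open>tensor_mult_eq\<close> are handled together.\<close>

lemma tensor_list:
  assumes "complex_vector.subspace (core A)"
  shows "\<exists>us. t = (\<Sum>(a, b)\<leftarrow>us. a \<otimes> b) \<and> (t \<in> tensor_core A B \<longrightarrow> set us \<subseteq> core A \<times> core B)"
proof (cases "t \<in> tensor_core A B")
  case True
  then show ?thesis using tensor_core_list[OF assms] by blast
next
  case False
  have "\<exists>us. t = (\<Sum>(a, b)\<leftarrow>us. a \<otimes> b)"
  proof (induction t rule: tensor_induct)
    case zero
    then show ?case by (intro exI[of _ "[]"]) simp
  next
    case (pure a b)
    then show ?case by (intro exI[of _ "[(a, b)]"]) simp
  next
    case (add s t)
    then obtain us vs where "s = (\<Sum>(a, b)\<leftarrow>us. a \<otimes> b)" "t = (\<Sum>(a, b)\<leftarrow>vs. a \<otimes> b)" by blast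
    then show ?case by (intro exI[of _ "us @ vs"]) simp
  qed
  with False show ?thesis by blast
qed

section \<open>Algebraic laws of the tensor product, reduced to pure tensors\<close>

locale quasi_star_algebra_pair = A: quasi_star_algebra A + B: quasi_star_algebra B
  for A :: "'a::complex_vector quasi_alg" and B :: "'b::complex_vector quasi_alg"
begin

abbreviation "T \<equiv> tensor_mult A B"
abbreviation "C \<equiv> tensor_core A B"

lemmas adj_pure = tensor_adj_pure[OF A.quasi_star_algebra_axioms B.quasi_star_algebra_axioms]
lemmas adj_add = tensor_adj_add[OF A.quasi_star_algebra_axioms B.quasi_star_algebra_axioms]
lemmas adj_scale = tensor_adj_scale[OF A.quasi_star_algebra_axioms B.quasi_star_algebra_axioms]
lemmas T_eq = tensor_mult_eq[OF A.quasi_star_algebra_axioms B.quasi_star_algebra_axioms]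
lemmas C_induct [consumes 1, case_names zero pure add] = tensor_core_induct[OF A.core_subspace]
lemmas list = tensor_list[OF A.core_subspace, of _ B]

lemma adj_zero: "tensor_adj A B 0 = 0"
  using adj_add[of 0 0] by simp

lemma T_pure:
  assumes "x \<in> core A \<and> y \<in> core B \<or> a \<in> core A \<and> b \<in> core B"
  shows "T (a \<otimes> b) (x \<otimes> y) = (a \<cdot>\<^bsub>A\<^esub> x) \<otimes> (b \<cdot>\<^bsub>B\<^esub> y)"
  using T_eq[of "[(x, y)]" "[(a, b)]"] assms by auto

text \<open>Concatenating lists that represent \<open>s\<close> and \<open>s'\<close> represents the
  sum, and the concatenation stays in the cores if both lists do.\<close>

lemma T_add_left:
  assumes "t \<in> C \<or> s \<in> C \<and> s' \<in> C"
  shows "T (s + s') t = T s t + T s' t"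
proof -
  obtain us us' vs where
    "s = (\<Sum>(a, b)\<leftarrow>us. a \<otimes> b)" "s \<in> C \<longrightarrow> set us \<subseteq> core A \<times> core B"
    "s' = (\<Sum>(a, b)\<leftarrow>us'. a \<otimes> b)" "s' \<in> C \<longrightarrow> set us' \<subseteq> core A \<times> core B"
    "t = (\<Sum>(a, b)\<leftarrow>vs. a \<otimes> b)" "t \<in> C \<longrightarrow> set vs \<subseteq> core A \<times> core B"
    using list by meson
  with assms show ?thesis
    using T_eq[of vs us] T_eq[of vs us'] T_eq[of vs "us @ us'"] by auto
qed

lemma T_add_right:
  assumes "s \<in> C \<or> t \<in> C \<and> t' \<in> C"
  shows "T s (t + t') = T s t + T s t'"
proof -
  obtain us vs vs' where
    "s = (\<Sum>(a, b)\<leftarrow>us. a \<otimes> b)" "s \<in> C \<longrightarrow> set us \<subseteq> core A \<times> core B"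
    "t = (\<Sum>(a, b)\<leftarrow>vs. a \<otimes> b)" "t \<in> C \<longrightarrow> set vs \<subseteq> core A \<times> core B"
    "t' = (\<Sum>(a, b)\<leftarrow>vs'. a \<otimes> b)" "t' \<in> C \<longrightarrow> set vs' \<subseteq> core A \<times> core B"
    using list by meson
  moreover have "(\<Sum>(a, b)\<leftarrow>us. \<Sum>(x, y)\<leftarrow>vs @ vs'. (a \<cdot>\<^bsub>A\<^esub> x) \<otimes> (b \<cdot>\<^bsub>B\<^esub> y)) =
      (\<Sum>(a, b)\<leftarrow>us. \<Sum>(x, y)\<leftarrow>vs. (a \<cdot>\<^bsub>A\<^esub> x) \<otimes> (b \<cdot>\<^bsub>B\<^esub> y)) +
      (\<Sum>(a, b)\<leftarrow>us. \<Sum>(x, y)\<leftarrow>vs'. (a \<cdot>\<^bsub>A\<^esub> x) \<otimes> (b \<cdot>\<^bsub>B\<^esub> y))"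
    by (induction us) (auto simp: algebra_simps)
  ultimately show ?thesis
    using assms T_eq[of vs us] T_eq[of vs' us] T_eq[of "vs @ vs'" us] by auto
qed

text \<open>The core contains 0, so additivity at 0 + 0 is available for every \<open>t\<close>, in
  the core or not.\<close>

lemma T_zero_left: "T 0 t = 0"
  using T_add_left[of t 0 0] by simp

lemma T_zero_right: "T s 0 = 0"
  using T_add_right[of s 0 0] by simp

lemma T_scale_left:
  assumes "s \<in> C \<or> t \<in> C"
  shows "T (c *\<^sub>C s) t = c *\<^sub>C T s t"
  using assms
proof
  assume "t \<in> C"
  then show ?thesis
  proof (induction t rule: C_induct)
    case (pure x y)
    interpret R: Vector_Spaces.linear scaleC scaleC "\<lambda>a. a \<cdot>\<^bsub>A\<^esub> x"
      using pure by (intro A.right_mult_linear)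
    from pure show ?case
      by (induction s rule: tensor_induct)
        (simp_all add: T_zero_left T_pure T_add_left tensor_core_pure scaleC_add_right R.scale
          flip: tensor_scale_left)
  qed (simp_all add: T_zero_right T_add_right scaleC_add_right)
next
  assume "s \<in> C"
  then show ?thesis
  proof (induction s rule: C_induct)
    case (pure x y)
    then have "c *\<^sub>C x \<in> core A" by (intro A.core_scale)
    with pure show ?case
      by (induction t rule: tensor_induct)
        (simp_all add: T_zero_right T_pure T_add_right tensor_core_pure scaleC_add_right
          A.core_scale_mult flip: tensor_scale_left)
  qed (simp_all add: T_zero_left T_add_left tensor_core_scale scaleC_add_right)
qed

lemma T_scale_right:
  assumes "s \<in> C \<or> t \<in> C"
  shows "T s (c *\<^sub>C t) = c *\<^sub>C T s t"
  using assms
proof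
  assume "t \<in> C"
  then show ?thesis
  proof (induction t rule: C_induct)
    case (pure x y)
    then have "c *\<^sub>C x \<in> core A" by (intro A.core_scale)
    with pure show ?case
      by (induction s rule: tensor_induct)
        (simp_all add: T_zero_left T_pure T_add_left tensor_core_pure scaleC_add_right
          A.mult_scale_core flip: tensor_scale_left)
  qed (simp_all add: T_zero_right T_add_right tensor_core_scale scaleC_add_right)
next
  assume "s \<in> C"
  then show ?thesis
  proof (induction s rule: C_induct)
    case (pure x y)
    interpret L: Vector_Spaces.linear scaleC scaleC "\<lambda>a. x \<cdot>\<^bsub>A\<^esub> a"
      using pure by (intro A.left_mult_linear)
    from pure show ?case
      by (induction t rule: tensor_induct)
        (simp_all add: T_zero_right T_pure T_add_right tensor_core_pure scaleC_add_right L.scale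
          flip: tensor_scale_left)
  qed (simp_all add: T_zero_left T_add_left scaleC_add_right)
qed

lemma C_mult: "\<lbrakk>s \<in> C; t \<in> C\<rbrakk> \<Longrightarrow> T s t \<in> C"
proof (induction s rule: C_induct)
  case (pure x y)
  \<comment> \<open>The membership of \<open>t\<close> is moved to the front because the nested
    induction consumes it.\<close>
  from pure(3,1,2) show ?case
    by (induction t rule: C_induct)
      (simp_all add: T_zero_right T_pure T_add_right tensor_core_pure tensor_core_add
        A.core_mult B.core_mult)
qed (simp_all add: T_zero_left T_add_left tensor_core_add)

lemma C_adj: "t \<in> C \<Longrightarrow> tensor_adj A B t \<in> C"
  by (induction t rule: C_induct)
    (simp_all add: adj_zero adj_pure adj_add tensor_core_pure tensor_core_add A.core_adj B.core_adj)

lemmas T_simps = T_zero_left T_zero_right T_pure T_add_left T_add_right tensor_core_pure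
  tensor_core_add C_mult C_adj adj_zero adj_pure adj_add
  A.core_mult B.core_mult A.core_adj B.core_adj

text \<open>Both sides are additive in all three arguments, with enough factors in the core at every
  stage, so the identity reduces to pure tensors and there to the same axiom of the two factors. The
  next laws follow this pattern.\<close>

lemma T_assoc_mid: "\<lbrakk>s \<in> C; t \<in> C\<rbrakk> \<Longrightarrow> T (T s u) t = T s (T u t)"
proof (induction s rule: C_induct)
  case (pure x y)
  from pure(3,1,2) show ?case
  proof (induction t rule: C_induct)
    case (pure x' y')
    then show ?case
      by (induction u rule: tensor_induct)
        (simp_all add: T_simps A.mult_assoc_mid B.mult_assoc_mid)
  qed (simp_all add: T_simps)
qed (simp_all add: T_simps)

lemma T_assoc_right: "\<lbrakk>s \<in> C; t \<in> C\<rbrakk> \<Longrightarrow> T u (T s t) = T (T u s) t"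
proof (induction s rule: C_induct)
  case (pure x y)
  from pure(3,1,2) show ?case
  proof (induction t rule: C_induct)
    case (pure x' y')
    then show ?case
      by (induction u rule: tensor_induct)
        (simp_all add: T_simps A.mult_assoc_right B.mult_assoc_right)
  qed (simp_all add: T_simps)
qed (simp_all add: T_simps)

lemma adj_T_right: "s \<in> C \<Longrightarrow> tensor_adj A B (T u s) = T (tensor_adj A B s) (tensor_adj A B u)"
proof (induction s rule: C_induct)
  case (pure x y)
  then show ?case
    by (induction u rule: tensor_induct)
      (simp_all add: T_simps A.adj_mult_right B.adj_mult_right)
qed (simp_all add: T_simps)

lemma adj_T_left: "s \<in> C \<Longrightarrow> tensor_adj A B (T s u) = T (tensor_adj A B u) (tensor_adj A B s)"
proof (induction s rule: C_induct)
  case (pure x y)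
  then show ?case
    by (induction u rule: tensor_induct)
      (simp_all add: T_simps A.adj_mult_left B.adj_mult_left)
qed (simp_all add: T_simps)

lemma adj_adj: "tensor_adj A B (tensor_adj A B t) = t"
  by (induction t rule: tensor_induct) (simp_all add: T_simps A.adj_adj B.adj_adj)

lemma quasi_star_algebra_tensor: "quasi_star_algebra (tensor_quasi_alg A B n)"
proof (unfold_locales, goal_cases)
  case 1
  then show ?case by (simp add: tensor_quasi_alg_def tensor_core_def complex_vector.subspace_span)
qed (simp_all add: tensor_quasi_alg_def linear_scaleC_iff T_simps T_scale_left T_scale_right
    T_assoc_mid T_assoc_right adj_T_right adj_T_left adj_adj adj_scale)

end

section \<open>Density of the core and continuity of multiplication on the tensor product\<close>

lemma tensor_core_dense:
  assumes A: "normed_quasi_star_algebra A" and B: "normed_quasi_star_algebra B"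
    and n: "cross_norm (nrm A) (nrm B) n" and e: "e > 0"
  shows "\<exists>x\<in>tensor_core A B. n (x - t) < e"
  using e
proof (induction t arbitrary: e rule: tensor_induct)
  case zero
  have "n 0 = 0" using n is_norm_eq_0[of n] by (simp add: cross_norm_def)
  then show ?case using zero by (intro bexI[of _ 0]) simp_all
next
  case (pure a b)
  interpret A: normed_quasi_star_algebra A by (rule A)
  interpret B: normed_quasi_star_algebra B by (rule B)
  have n': "is_norm n" "\<And>a b. n (a \<otimes> b) = nrm A a * nrm B b"
    using n by (auto simp: cross_norm_def)
  have approxA: "\<exists>x\<in>core A. nrm A (x - a) * k < d" and approxB: "\<exists>y\<in>core B. k * nrm B (y - b) < d"
    if "d > 0" "k \<ge> 0" for d k
  proof -
    \<comment> \<open>Dividing by k + 1 instead of k also covers k = 0.\<close>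
    have pos: "d / (k + 1) > 0" using that by simp
    have less: "k * z < d" "z * k < d" if "z < d / (k + 1)" "0 \<le> z" for z
    proof -
      have "k * z \<le> (k + 1) * z" using that by (simp add: algebra_simps)
      also have "\<dots> < d" using that \<open>k \<ge> 0\<close> by (simp add: field_simps)
      finally show "k * z < d" "z * k < d" by (simp_all add: mult.commute)
    qed
    show "\<exists>x\<in>core A. nrm A (x - a) * k < d"
      using A.core_dense in_norm_closure_iff[OF A.is_norm, of a "core A"] pos less(2)
        is_norm_nonneg[OF A.is_norm] by (metis UNIV_I)
    show "\<exists>y\<in>core B. k * nrm B (y - b) < d"
      using B.core_dense in_norm_closure_iff[OF B.is_norm, of b "core B"] pos less(1)
        is_norm_nonneg[OF B.is_norm] by (metis UNIV_I)
  qed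
  \<comment> \<open>The order matters: the accuracy required of \<open>x\<close> depends on the norm
    of the chosen \<open>y\<close>.\<close>
  obtain y where y: "y \<in> core B" "nrm A a * nrm B (y - b) < e / 2"
    using approxB[of "e / 2" "nrm A a"] pure is_norm_nonneg[OF A.is_norm] by auto
  obtain x where x: "x \<in> core A" "nrm A (x - a) * nrm B y < e / 2"
    using approxA[of "e / 2" "nrm B y"] pure is_norm_nonneg[OF B.is_norm] by auto
  \<comment> \<open>With \<open>a \<otimes> y\<close> in between, both differences are pure tensors,
    whose norms the cross-norm property computes.\<close>
  have "n (x \<otimes> y - a \<otimes> b) \<le> n (x \<otimes> y - a \<otimes> y) + n (a \<otimes> y - a \<otimes> b)"
    by (rule is_norm_triangle_diff[OF n'(1)])
  also have "\<dots> < e"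
    using x y by (simp add: n'(2) flip: tensor_diff_left tensor_diff_right)
  finally show ?case using x y by (intro bexI[of _ "x \<otimes> y"]) (simp_all add: tensor_core_pure)
next
  case (add s t)
  have n': "is_norm n" using n by (simp add: cross_norm_def)
  obtain x y where xy: "x \<in> tensor_core A B" "n (x - s) < e / 2" "y \<in> tensor_core A B" "n (y - t) < e / 2"
    using add.IH[of "e / 2"] add.prems by auto
  have "n ((x + y) - (s + t)) \<le> n (x - s) + n (y - t)"
    using is_norm_triangle[OF n', of "x - s" "y - t"] by (simp add: algebra_simps)
  then show ?case using xy by (intro bexI[of _ "x + y"]) (simp_all add: tensor_core_add)
qed

text \<open>Right multiplication by \<open>x \<otimes> y\<close> is the tensor product of two
  bounded right multiplications, so uniformity bounds it; finite sums add the constants.\<close>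

lemma tensor_right_mult_bounded:
  assumes A: "normed_quasi_star_algebra A" and B: "normed_quasi_star_algebra B"
    and n: "uniform_cross_norm (nrm A) (nrm B) n" and t: "t \<in> tensor_core A B"
  shows "\<exists>K. \<forall>s. n (tensor_mult A B s t) \<le> K * n s"
proof -
  interpret A: normed_quasi_star_algebra A by (rule A)
  interpret B: normed_quasi_star_algebra B by (rule B)
  interpret quasi_star_algebra_pair A B ..
  have n': "is_norm n" using n by (simp add: uniform_cross_norm_def cross_norm_def)
  show ?thesis
    using t
  proof (induction t rule: C_induct)
    case zero
    then show ?case by (intro exI[of _ 0]) (simp add: T_zero_right is_norm_eq_0[OF n', THEN iffD2])
  next
    case (pure x y)
    let ?R = "\<lambda>a. a \<cdot>\<^bsub>A\<^esub> x" and ?S = "\<lambda>b. b \<cdot>\<^bsub>B\<^esub> y"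
    have RS: "bounded_operator (nrm A) ?R" "bounded_operator (nrm B) ?S"
      using A.right_mult_linear A.right_mult_bounded B.right_mult_linear B.right_mult_bounded pure
      unfolding bounded_operator_def by blast+
    then have lin: "Vector_Spaces.linear scaleC scaleC ?R" "Vector_Spaces.linear scaleC scaleC ?S"
      unfolding bounded_operator_def by blast+
    interpret RS: Vector_Spaces.linear scaleC scaleC "tensor_map ?R ?S"
      by (rule linear_tensor_map[OF lin])
    have "tensor_map ?R ?S s = T s (x \<otimes> y)" for s
      using pure by (induction s rule: tensor_induct)
        (simp_all add: RS.zero RS.add T_simps tensor_map_pure[OF lin])
    then show ?case
      using n RS unfolding uniform_cross_norm_def bounded_operator_def by metis
  next
    case (add t u)
    then obtain K L where "\<And>s. n (T s t) \<le> K * n s" "\<And>s. n (T s u) \<le> L * n s" by blast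
    moreover have "n (T s (t + u)) \<le> n (T s t) + n (T s u)" for s
      using add is_norm_triangle[OF n'] by (simp add: T_add_right)
    ultimately have "n (T s (t + u)) \<le> (K + L) * n s" for s
      unfolding distrib_right by (meson add_mono order_trans)
    then show ?case by blast
  qed
qed

lemma normed_quasi_star_algebra_tensor:
  assumes A: "normed_quasi_star_algebra A" and B: "normed_quasi_star_algebra B"
    and n: "uniform_cross_norm (nrm A) (nrm B) n"
    and isometric: "\<And>t. n (tensor_adj A B t) = n t"
  shows "normed_quasi_star_algebra (tensor_quasi_alg A B n)"
proof -
  interpret A: normed_quasi_star_algebra A by (rule A)
  interpret B: normed_quasi_star_algebra B by (rule B)
  interpret quasi_star_algebra_pair A B ..
  interpret AB: quasi_star_algebra "tensor_quasi_alg A B n" by (rule quasi_star_algebra_tensor)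
  have n': "is_norm n" "\<And>a b. n (a \<otimes> b) = nrm A a * nrm B b" "cross_norm (nrm A) (nrm B) n"
    using n by (auto simp: uniform_cross_norm_def cross_norm_def)
  have [simp]: "core (tensor_quasi_alg A B n) = C" "mult (tensor_quasi_alg A B n) = T"
    "adj (tensor_quasi_alg A B n) = tensor_adj A B" "nrm (tensor_quasi_alg A B n) = n"
    by (simp_all add: tensor_quasi_alg_def)
  show ?thesis
  proof (unfold_locales, goal_cases)
    case 1
    obtain e f where e: "e \<in> core A" "\<And>a. a \<cdot>\<^bsub>A\<^esub> e = a \<and> e \<cdot>\<^bsub>A\<^esub> a = a" "nrm A e = 1"
      and f: "f \<in> core B" "\<And>b. b \<cdot>\<^bsub>B\<^esub> f = b \<and> f \<cdot>\<^bsub>B\<^esub> b = b" "nrm B f = 1"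
      using A.unital B.unital by blast
    have "T t (e \<otimes> f) = t \<and> T (e \<otimes> f) t = t" for t
      using e f by (induction t rule: tensor_induct) (simp_all add: T_simps)
    then show ?case using e f by (intro bexI[of _ "e \<otimes> f"]) (simp_all add: n' tensor_core_pure)
  next
    case 2
    then show ?case by (simp add: n')
  next
    case (3 t)
    then show ?case by (simp add: isometric)
  next
    case 4
    then show ?case
      using tensor_core_dense[OF A B n'(3)] by (auto simp: in_norm_closure_iff[OF n'(1)])
  next
    case (5 t)
    then show ?case
      using tensor_right_mult_bounded[OF A B n] AB.right_mult_linear[OF 5]
      by (simp add: continuous_operator_iff[OF n'(1)])
  qed
qed

section \<open>The Schur product theorem\<close>

text \<open>The conjugate sits on the first index to match the Gram matrices
  \<open>\<omega> (adj A (x i) \<cdot> x j)\<close>, whose form is conjugate-linear in the first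
  vector.\<close>

definition psd :: "'i set \<Rightarrow> ('i \<Rightarrow> 'i \<Rightarrow> complex) \<Rightarrow> bool" where
  "psd I H \<longleftrightarrow> (\<forall>i\<in>I. \<forall>j\<in>I. H j i = cnj (H i j)) \<and>
     (\<forall>c. 0 \<le> (\<Sum>i\<in>I. \<Sum>j\<in>I. cnj (c i) * c j * H i j))"

lemma psd_herm: "\<lbrakk>psd I H; i \<in> I; j \<in> I\<rbrakk> \<Longrightarrow> H j i = cnj (H i j)"
  and psd_nonneg: "psd I H \<Longrightarrow> 0 \<le> (\<Sum>i\<in>I. \<Sum>j\<in>I. cnj (c i) * c j * H i j)"
  unfolding psd_def by blast+

lemma psd_subset:
  assumes "psd J H" "finite J" "I \<subseteq> J"
  shows "psd I H"
  unfolding psd_def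
proof (intro conjI ballI allI)
  show "H j i = cnj (H i j)" if "i \<in> I" "j \<in> I" for i j
    using psd_herm[OF assms(1)] that assms(3) by blast
  show "0 \<le> (\<Sum>i\<in>I. \<Sum>j\<in>I. cnj (c i) * c j * H i j)" for c
  proof -
    define d where "d i = (if i \<in> I then c i else 0)" for i
    have "(\<Sum>i\<in>J. \<Sum>j\<in>J. cnj (d i) * d j * H i j) = (\<Sum>i\<in>I. \<Sum>j\<in>J. cnj (d i) * d j * H i j)"
      using assms by (intro sum.mono_neutral_right) (auto simp: d_def)
    also have "\<dots> = (\<Sum>i\<in>I. \<Sum>j\<in>I. cnj (d i) * d j * H i j)"
      using assms by (intro sum.cong sum.mono_neutral_right) (auto simp: d_def)
    also have "\<dots> = (\<Sum>i\<in>I. \<Sum>j\<in>I. cnj (c i) * c j * H i j)"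
      by (simp add: d_def)
    finally show ?thesis using psd_nonneg[OF assms(1), of d] by simp
  qed
qed

lemma psd_diag_nonneg:
  assumes "psd I H" "finite I" "p \<in> I"
  shows "0 \<le> H p p"
  using psd_nonneg[OF psd_subset[OF assms(1,2), of "{p}"], of "\<lambda>_. 1"] assms(3) by simp

text \<open>With \<open>H p p = 0\<close> the form at the vector with entries 1 at \<open>i\<close>
  and t at \<open>p\<close> is real-affine in t. Being bounded below it is constant, which forces
  the off-diagonal entry to vanish.\<close>

lemma psd_diag_zero:
  assumes psd: "psd I H" "finite I" and p: "p \<in> I" "H p p = 0" and i: "i \<in> I"
  shows "H i p = 0" "H p i = 0"
proof -
  show "H i p = 0"
  proof (cases "i = p")
    case False
    show ?thesis
    proof (rule ccontr)
      assume nz: "H i p \<noteq> 0"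
      have sub: "psd {i, p} H" using psd_subset[OF psd] p i by simp
      have le: "2 * r * (cmod (H i p))\<^sup>2 \<le> Re (H i i)" for r
      proof -
        define t where "t = - complex_of_real r * cnj (H i p)"
        have pi: "H p i = cnj (H i p)" using psd_herm[OF psd(1) i p(1)] .
        have "0 \<le> H i i + t * H i p + cnj t * H p i"
          using psd_nonneg[OF sub, of "\<lambda>k. if k = p then t else 1"] False p(2)
          by (simp add: add.assoc)
        then have "0 \<le> Re (H i i + t * H i p + cnj t * H p i)" by (simp add: less_eq_complex_def)
        then show ?thesis
          unfolding t_def pi cmod_power2 by (simp add: algebra_simps power2_eq_square)
      qed
      have "(cmod (H i p))\<^sup>2 > 0" using nz by simp
      \<comment> \<open>This choice of r makes the left side of \<open>le\<close> equal to
        \<open>Re (H i i) + 1\<close>.\<close>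
      then show False
        using le[of "(Re (H i i) + 1) / (2 * (cmod (H i p))\<^sup>2)"] by simp
    qed
  qed (use p in simp)
  then show "H p i = 0" using psd_herm[OF psd(1) i p(1)] by simp
qed

text \<open>If \<open>H p p = 0\<close>, the convention \<open>z / 0 = 0\<close> makes the Schur complement equal to \<open>H\<close>.\<close>

lemma psd_schur_complement:
  assumes psd: "psd (insert p I) H" and I: "finite I" "p \<notin> I"
  shows "psd I (\<lambda>i j. H i j - H i p * H p j / H p p)"
proof (cases "H p p = 0")
  case True
  then show ?thesis using psd_subset[OF psd] I by (simp add: subset_insertI)
next
  case False
  define h where "h = H p p"
  have h: "h \<noteq> 0" "cnj h = h"
    using False psd_herm[OF psd, of p p] by (simp_all add: h_def)
  have herm: "H j i = cnj (H i j)" if "i \<in> insert p I" "j \<in> insert p I" for i j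
    using psd_herm[OF psd that] .
  show ?thesis
    unfolding psd_def h_def[symmetric]
  proof (intro conjI ballI allI)
    show "H j i - H j p * H p i / h = cnj (H i j - H i p * H p j / h)" if "i \<in> I" "j \<in> I" for i j
      using that herm[of i j] herm[of p j] herm[of i p] h by (simp add: mult.commute)
    fix c
    define z where "z = (\<Sum>j\<in>I. c j * H p j)"
    \<comment> \<open>Completing the square: - z / h is the value of the coordinate \<open>p\<close>
      that minimises the form when the other coordinates are \<open>c\<close>, and the minimum is
      the form of the Schur complement at \<open>c\<close>.\<close>
    define d where "d i = (if i = p then - z / h else c i)" for i
    have d: "d p = - z / h" "\<And>i. i \<in> I \<Longrightarrow> d i = c i" using I by (auto simp: d_def)
    have z': "cnj z = (\<Sum>i\<in>I. cnj (c i) * H i p)"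
      unfolding z_def cnj_sum by (intro sum.cong refl) (simp only: complex_cnj_mult herm[of p] insert_iff simp_thms)
    let ?Q = "\<Sum>i\<in>I. \<Sum>j\<in>I. cnj (c i) * c j * H i j"
    have 1: "(\<Sum>i\<in>I. cnj (d i) * d p * H i p) = d p * cnj z"
      unfolding z' sum_distrib_left by (intro sum.cong) (simp_all add: d)
    have 2: "(\<Sum>j\<in>I. cnj (d p) * d j * H p j) = cnj (d p) * z"
      unfolding z_def sum_distrib_left by (intro sum.cong) (simp_all add: d)
    have 3: "(\<Sum>i\<in>I. \<Sum>j\<in>I. cnj (d i) * d j * H i j) = ?Q"
      by (intro sum.cong) (simp_all add: d)
    have "(\<Sum>i\<in>insert p I. \<Sum>j\<in>insert p I. cnj (d i) * d j * H i j)
        = cnj (d p) * d p * h + cnj (d p) * z + (d p * cnj z + ?Q)"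
      using I by (simp add: sum.distrib 1 2 3 h_def)
    also have "\<dots> = ?Q - cnj z * z / h"
      using h by (simp add: d(1) field_simps)
    also have "\<dots> = (\<Sum>i\<in>I. \<Sum>j\<in>I. cnj (c i) * c j * (H i j - H i p * H p j / h))"
      unfolding right_diff_distrib sum_subtractf
      by (subst z', subst z_def, unfold sum_product sum_divide_distrib) (simp add: ac_simps)
    finally show "0 \<le> (\<Sum>i\<in>I. \<Sum>j\<in>I. cnj (c i) * c j * (H i j - H i p * H p j / h))"
      using psd_nonneg[OF psd, of d] by simp
  qed
qed

text \<open>Splitting off the rank one matrix \<open>H i p * H p j / H p p\<close> leaves the Schur complement,
  whose row and column \<open>p\<close> vanish.\<close>

lemma schur_product_nonneg:
  assumes "finite I" "psd I H" "psd I K"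
  shows "0 \<le> (\<Sum>i\<in>I. \<Sum>j\<in>I. H i j * K i j)"
  using assms
\<comment> \<open>\<open>H\<close> is generalised because the induction hypothesis is applied to the
  Schur complement \<open>L\<close>, while \<open>K\<close> is merely restricted to the smaller
  index set.\<close>
proof (induction I arbitrary: H rule: finite_induct)
  case (insert p I)
  let ?J = "insert p I"
  define L where "L i j = H i j - H i p * H p j / H p p" for i j
  have fin: "finite ?J" using insert by simp
  \<comment> \<open>For \<open>H p p \<noteq> 0\<close> the subtraction cancels these entries;
    otherwise \<open>L\<close> is \<open>H\<close>, whose row and column \<open>p\<close> vanish by
    positivity.\<close>
  have zero: "L p j = 0" "L j p = 0" if "j \<in> ?J" for j
    using psd_diag_zero[OF insert.prems(1) fin _ _ that] by (cases "H p p = 0"; simp add: L_def)+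
  have "0 \<le> (\<Sum>i\<in>I. \<Sum>j\<in>I. L i j * K i j)"
    using insert psd_schur_complement[OF insert.prems(1)] psd_subset[OF insert.prems(2) fin]
    unfolding L_def by blast
  also have "\<dots> = (\<Sum>i\<in>?J. \<Sum>j\<in>?J. L i j * K i j)"
    using insert(1,2) zero by simp
  finally have L: "0 \<le> (\<Sum>i\<in>?J. \<Sum>j\<in>?J. L i j * K i j)" .
  have pp: "0 \<le> H p p" using psd_diag_nonneg[OF insert.prems(1) fin] by simp
  \<comment> \<open>Up to the factor 1 / \<open>H p p\<close>, the rank one part paired with
    \<open>K\<close> is the quadratic form of \<open>K\<close> at the vector
    \<open>H p\<close>.\<close>
  have "(\<Sum>i\<in>?J. \<Sum>j\<in>?J. H i p * H p j / H p p * K i j)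
      = (\<Sum>i\<in>?J. \<Sum>j\<in>?J. cnj (H p i) * H p j * K i j) / H p p"
    unfolding sum_divide_distrib
  proof (intro sum.cong refl)
    fix i j assume "i \<in> ?J"
    then have "H i p = cnj (H p i)" using psd_herm[OF insert.prems(1), of p i] by simp
    then show "H i p * H p j / H p p * K i j = cnj (H p i) * H p j * K i j / H p p" by simp
  qed
  also have "0 \<le> \<dots>"
    using psd_nonneg[OF insert.prems(2), of "H p"] pp
    by (auto simp: less_eq_complex_def Re_divide Im_divide)
  finally have "0 \<le> (\<Sum>i\<in>?J. \<Sum>j\<in>?J. H i p * H p j / H p p * K i j)" .
  moreover have "(\<Sum>i\<in>?J. \<Sum>j\<in>?J. H i j * K i j) =
      (\<Sum>i\<in>?J. \<Sum>j\<in>?J. H i p * H p j / H p p * K i j) + (\<Sum>i\<in>?J. \<Sum>j\<in>?J. L i j * K i j)"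
    unfolding sum.distrib[symmetric] L_def by (intro sum.cong) (simp_all add: algebra_simps)
  ultimately show ?case using L by simp
qed simp

lemma psd_rank_one: "psd I (\<lambda>i j. cnj (f i) * f j)"
  unfolding psd_def
proof (intro conjI ballI allI)
  fix c
  let ?s = "\<Sum>i\<in>I. c i * f i"
  have "0 \<le> cnj z * z" for z by (simp add: less_eq_complex_def)
  moreover have "(\<Sum>i\<in>I. \<Sum>j\<in>I. cnj (c i) * c j * (cnj (f i) * f j)) = cnj ?s * ?s"
    unfolding cnj_sum sum_product by (simp add: ac_simps)
  ultimately show "0 \<le> (\<Sum>i\<in>I. \<Sum>j\<in>I. cnj (c i) * c j * (cnj (f i) * f j))"
    by metis
qed simp

text \<open>Writing each matrix as its excess over the rank one matrix plus that matrix splits the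
  entrywise product into four terms. Three are nonnegative by the Schur product theorem, and the
  product of the two rank one matrices sums to the squared modulus on the left.\<close>

lemma schur_product_rank_one_bound:
  assumes I: "finite I" and H: "psd I (\<lambda>i j. H i j - cnj (f i) * f j)"
    and K: "psd I (\<lambda>i j. K i j - cnj (g i) * g j)"
  shows "(cmod (\<Sum>i\<in>I. f i * g i))\<^sup>2 \<le> Re (\<Sum>i\<in>I. \<Sum>j\<in>I. H i j * K i j)"
proof -
  let ?s = "\<Sum>i\<in>I. f i * g i"
  let ?X = "\<Sum>i\<in>I. \<Sum>j\<in>I. (H i j - cnj (f i) * f j) * (K i j - cnj (g i) * g j)"
  let ?Z = "\<Sum>i\<in>I. \<Sum>j\<in>I. (H i j - cnj (f i) * f j) * (cnj (g i) * g j)"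
  let ?Y = "\<Sum>i\<in>I. \<Sum>j\<in>I. cnj (f i) * f j * (K i j - cnj (g i) * g j)"
  have "cnj ?s * ?s = (\<Sum>i\<in>I. \<Sum>j\<in>I. cnj (f i) * f j * (cnj (g i) * g j))"
    unfolding cnj_sum sum_product by (simp add: ac_simps)
  then have "(\<Sum>i\<in>I. \<Sum>j\<in>I. H i j * K i j) = ?X + ?Y + ?Z + cnj ?s * ?s"
    by (simp add: sum.distrib[symmetric] algebra_simps)
  moreover have "0 \<le> ?X" "0 \<le> ?Y" "0 \<le> ?Z"
    by (rule schur_product_nonneg I H K psd_rank_one)+
  moreover have "Re (cnj ?s * ?s) = (cmod ?s)\<^sup>2"
    by (metis complex_norm_square mult.commute Re_complex_of_real)
  ultimately show ?thesis by (simp add: less_eq_complex_def)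
qed

section \<open>Gram matrices of representable functionals\<close>

text \<open>For arbitrary \<open>a\<close>, left multiplication is assumed linear on the core only,
  so the sum is split by induction within the core.\<close>

lemma (in quasi_star_algebra) mult_core_lincomb:
  assumes "finite I" "\<And>i. i \<in> I \<Longrightarrow> x i \<in> core A"
  shows "a \<cdot> (\<Sum>i\<in>I. c i *\<^sub>C x i) = (\<Sum>i\<in>I. c i *\<^sub>C (a \<cdot> x i))"
  using assms
proof (induction I rule: finite_induct)
  case empty
  show ?case
    using mult_scale_core[of 0 a 0] complex_vector.subspace_0[OF core_subspace] by simp
next
  case (insert i I)
  then show ?case
    by (simp add: mult_add_core mult_scale_core core_scale core_sum)
qed

lemma (in quasi_star_algebra) representable_lincomb:
  assumes \<omega>: "representable A \<omega>" and I: "finite I" and x: "\<And>i. i \<in> I \<Longrightarrow> x i \<in> core A"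
  shows "\<omega> (a \<cdot> (\<Sum>i\<in>I. c i *\<^sub>C x i)) = (\<Sum>i\<in>I. c i * \<omega> (a \<cdot> x i))"
    and "\<omega> (adj A (\<Sum>i\<in>I. c i *\<^sub>C x i) \<cdot> (\<Sum>i\<in>I. c i *\<^sub>C x i)) =
      (\<Sum>i\<in>I. \<Sum>j\<in>I. cnj (c i) * c j * \<omega> (adj A (x i) \<cdot> x j))"
proof -
  interpret \<omega>: Vector_Spaces.linear scaleC "(*)" \<omega> by (rule representable_linear[OF \<omega>])
  show 1: "\<omega> (a \<cdot> (\<Sum>i\<in>I. c i *\<^sub>C x i)) = (\<Sum>i\<in>I. c i * \<omega> (a \<cdot> x i))" for a
    by (simp add: mult_core_lincomb[OF I x] \<omega>.sum \<omega>.scale)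
  have "\<omega> (adj A (\<Sum>i\<in>I. c i *\<^sub>C x i) \<cdot> x j) = (\<Sum>i\<in>I. cnj (c i) * \<omega> (adj A (x i) \<cdot> x j))"
    if "j \<in> I" for j
  proof -
    interpret R: Vector_Spaces.linear scaleC scaleC "\<lambda>a. a \<cdot> x j"
      by (rule right_mult_linear[OF x[OF that]])
    show ?thesis by (simp add: adj_sum adj_scale R.sum R.scale \<omega>.sum \<omega>.scale)
  qed
  then have "\<omega> (adj A (\<Sum>i\<in>I. c i *\<^sub>C x i) \<cdot> (\<Sum>i\<in>I. c i *\<^sub>C x i)) =
      (\<Sum>j\<in>I. \<Sum>i\<in>I. cnj (c i) * c j * \<omega> (adj A (x i) \<cdot> x j))"
    by (simp add: 1 sum_distrib_left ac_simps)
  also have "\<dots> = (\<Sum>i\<in>I. \<Sum>j\<in>I. cnj (c i) * c j * \<omega> (adj A (x i) \<cdot> x j))"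
    by (rule sum.swap)
  finally show "\<omega> (adj A (\<Sum>i\<in>I. c i *\<^sub>C x i) \<cdot> (\<Sum>i\<in>I. c i *\<^sub>C x i)) =
      (\<Sum>i\<in>I. \<Sum>j\<in>I. cnj (c i) * c j * \<omega> (adj A (x i) \<cdot> x j))" .
qed

context normed_quasi_star_algebra
begin

text \<open>The quadratic form at \<open>c\<close> is the value that (L.1) controls at the core
  element with coefficients \<open>c\<close>.\<close>

lemma psd_gram:
  assumes \<omega>: "representable A \<omega>" and I: "finite I" and x: "\<And>i. i \<in> I \<Longrightarrow> x i \<in> core A"
  shows "psd I (\<lambda>i j. \<omega> (adj A (x i) \<cdot> x j))"
  unfolding psd_def
proof (intro conjI ballI allI)
  show "\<omega> (adj A (x j) \<cdot> x i) = cnj (\<omega> (adj A (x i) \<cdot> x j))" if "i \<in> I" "j \<in> I" for i j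
    using sesq_hermitian[OF \<omega>] x that by blast
  fix c
  have "(\<Sum>i\<in>I. c i *\<^sub>C x i) \<in> core A" using x by (intro core_sum core_scale)
  then have "0 \<le> \<omega> (adj A (\<Sum>i\<in>I. c i *\<^sub>C x i) \<cdot> (\<Sum>i\<in>I. c i *\<^sub>C x i))"
    by (rule representable_pos[OF \<omega>])
  then show "0 \<le> (\<Sum>i\<in>I. \<Sum>j\<in>I. cnj (c i) * c j * \<omega> (adj A (x i) \<cdot> x j))"
    by (simp only: representable_lincomb(2)[OF \<omega> I x])
qed

text \<open>(L.3) says that the Gram matrix dominates a rank one matrix.\<close>

lemma psd_gram_minus:
  assumes \<omega>: "representable A \<omega>" and I: "finite I" and x: "\<And>i. i \<in> I \<Longrightarrow> x i \<in> core A"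
    and \<gamma>: "\<And>x. x \<in> core A \<Longrightarrow> cmod (\<omega> (a \<cdot> x)) \<le> \<gamma> * sqrt (Re (\<omega> (adj A x \<cdot> x)))"
  shows "psd I (\<lambda>i j. complex_of_real (\<gamma>\<^sup>2) * \<omega> (adj A (x i) \<cdot> x j) - cnj (\<omega> (a \<cdot> x i)) * \<omega> (a \<cdot> x j))"
  unfolding psd_def
proof (intro conjI ballI allI)
  show "complex_of_real (\<gamma>\<^sup>2) * \<omega> (adj A (x j) \<cdot> x i) - cnj (\<omega> (a \<cdot> x j)) * \<omega> (a \<cdot> x i) =
      cnj (complex_of_real (\<gamma>\<^sup>2) * \<omega> (adj A (x i) \<cdot> x j) - cnj (\<omega> (a \<cdot> x i)) * \<omega> (a \<cdot> x j))"
    if "i \<in> I" "j \<in> I" for i j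
    using sesq_hermitian[OF \<omega> x[OF that(1)] x[OF that(2)]] by simp
  fix c
  define z where "z = (\<Sum>i\<in>I. c i *\<^sub>C x i)"
  have z: "z \<in> core A" unfolding z_def using x by (intro core_sum core_scale)
  have lincomb: "\<omega> (a \<cdot> z) = (\<Sum>i\<in>I. c i * \<omega> (a \<cdot> x i))"
    "\<omega> (adj A z \<cdot> z) = (\<Sum>i\<in>I. \<Sum>j\<in>I. cnj (c i) * c j * \<omega> (adj A (x i) \<cdot> x j))"
    unfolding z_def by (rule representable_lincomb[OF \<omega> I x]; assumption)+
  have pos: "0 \<le> Re (\<omega> (adj A z \<cdot> z))" "Im (\<omega> (adj A z \<cdot> z)) = 0"
    using representable_pos[OF \<omega> z] by (simp_all add: less_eq_complex_def)
  have "(cmod (\<omega> (a \<cdot> z)))\<^sup>2 \<le> (\<gamma> * sqrt (Re (\<omega> (adj A z \<cdot> z))))\<^sup>2"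
    using \<gamma>[OF z] by (intro power_mono) simp_all
  then have "(cmod (\<omega> (a \<cdot> z)))\<^sup>2 \<le> \<gamma>\<^sup>2 * Re (\<omega> (adj A z \<cdot> z))"
    using pos by (simp add: power_mult_distrib)
  then have "0 \<le> complex_of_real (\<gamma>\<^sup>2) * \<omega> (adj A z \<cdot> z) - cnj (\<omega> (a \<cdot> z)) * \<omega> (a \<cdot> z)"
    using pos unfolding mult.commute[of "cnj _"] complex_norm_square[symmetric]
    by (simp add: less_eq_complex_def)
  also have "cnj (\<omega> (a \<cdot> z)) * \<omega> (a \<cdot> z) =
      (\<Sum>i\<in>I. \<Sum>j\<in>I. cnj (c i) * c j * (cnj (\<omega> (a \<cdot> x i)) * \<omega> (a \<cdot> x j)))"
    unfolding lincomb cnj_sum sum_product by (simp add: ac_simps)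
  also have "complex_of_real (\<gamma>\<^sup>2) * \<omega> (adj A z \<cdot> z) =
      (\<Sum>i\<in>I. \<Sum>j\<in>I. cnj (c i) * c j * (complex_of_real (\<gamma>\<^sup>2) * \<omega> (adj A (x i) \<cdot> x j)))"
    unfolding lincomb
    by (simp add: sum_distrib_left ac_simps)
  finally show "0 \<le> (\<Sum>i\<in>I. \<Sum>j\<in>I. cnj (c i) * c j *
      (complex_of_real (\<gamma>\<^sup>2) * \<omega> (adj A (x i) \<cdot> x j) - cnj (\<omega> (a \<cdot> x i)) * \<omega> (a \<cdot> x j)))"
    by (simp add: right_diff_distrib sum_subtractf)
qed

end

section \<open>Products of representable functionals\<close>

definition tensor_functional ::
    "('a::complex_vector \<Rightarrow> complex) \<Rightarrow> ('b::complex_vector \<Rightarrow> complex) \<Rightarrow> ('a, 'b) tensor \<Rightarrow> complex" where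
  "tensor_functional \<omega> \<psi> =
    (THE F. Vector_Spaces.linear scaleC (*) F \<and> (\<forall>a b. F (a \<otimes> b) = \<omega> a * \<psi> b))"

lemma tensor_functional:
  assumes \<omega>: "Vector_Spaces.linear scaleC (*) \<omega>" and \<psi>: "Vector_Spaces.linear scaleC (*) \<psi>"
  shows linear_tensor_functional: "Vector_Spaces.linear scaleC (*) (tensor_functional \<omega> \<psi>)"
    and tensor_functional_pure: "tensor_functional \<omega> \<psi> (a \<otimes> b) = \<omega> a * \<psi> b"
proof -
  interpret \<omega>: Vector_Spaces.linear scaleC "(*)" \<omega> by (rule \<omega>)
  interpret \<psi>: Vector_Spaces.linear scaleC "(*)" \<psi> by (rule \<psi>)
  have "\<exists>!F. Vector_Spaces.linear scaleC (*) F \<and> (\<forall>a b. F (a \<otimes> b) = \<omega> a * \<psi> b)"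
    by (rule tensor_universal_property[OF vector_space_complex])
      (simp_all add: linear_functional_iff \<omega>.add \<omega>.scale \<psi>.add \<psi>.scale algebra_simps)
  from theI'[OF this, folded tensor_functional_def]
  show "Vector_Spaces.linear scaleC (*) (tensor_functional \<omega> \<psi>)"
    and "tensor_functional \<omega> \<psi> (a \<otimes> b) = \<omega> a * \<psi> b"
    by blast+
qed

locale normed_quasi_star_algebra_pair =
  A: normed_quasi_star_algebra A + B: normed_quasi_star_algebra B
  for A :: "'a::complex_vector quasi_alg" and B :: "'b::complex_vector quasi_alg"
begin

sublocale quasi_star_algebra_pair A B ..

text \<open>(L.2) is additive in every argument and reduces to pure tensors. The inequalities (L.1)
  and (L.3) are not additive in the core element, which is kept as a whole sum; (L.3) is, however,
  stable under sums in the other argument, where induction applies.\<close>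

lemma representable_tensor_functional:
  assumes \<omega>: "representable A \<omega>" and \<psi>: "representable B \<psi>"
  shows "representable (tensor_quasi_alg A B n) (tensor_functional \<omega> \<psi>)"
proof -
  note lin = representable_linear[OF \<omega>] representable_linear[OF \<psi>]
  let ?F = "tensor_functional \<omega> \<psi>"
  note pure = tensor_functional_pure[OF lin]
  interpret F: Vector_Spaces.linear scaleC "(*)" ?F by (rule linear_tensor_functional[OF lin])
  interpret AB: quasi_star_algebra "tensor_quasi_alg A B n" by (rule quasi_star_algebra_tensor)
  have [simp]: "core (tensor_quasi_alg A B n) = C" "mult (tensor_quasi_alg A B n) = T"
    "adj (tensor_quasi_alg A B n) = tensor_adj A B"
    by (simp_all add: tensor_quasi_alg_def)
  have rep: "\<exists>x y (m::nat). t = (\<Sum>i<m. x i \<otimes> y i) \<and> (\<forall>i<m. x i \<in> core A \<and> y i \<in> core B)"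
    if t: "t \<in> C" for t
  proof -
    obtain us where us: "t = (\<Sum>(a, b)\<leftarrow>us. a \<otimes> b)" "set us \<subseteq> core A \<times> core B"
      using list t by blast
    have "t = (\<Sum>i<length us. fst (us ! i) \<otimes> snd (us ! i))"
      unfolding us(1) sum_list_sum_nth by (simp add: case_prod_beta atLeast0LessThan)
    moreover have "fst (us ! i) \<in> core A \<and> snd (us ! i) \<in> core B" if "i < length us" for i
      using us(2) nth_mem[OF that] by (auto simp: mem_Times_iff)
    ultimately show ?thesis
      by (intro exI[of _ "\<lambda>i. fst (us ! i)"] exI[of _ "\<lambda>i. snd (us ! i)"] exI[of _ "length us"]) simp
  qed
  have left: "?F (T (a \<otimes> b) (\<Sum>i<m. x i \<otimes> y i)) = (\<Sum>i<m. \<omega> (a \<cdot>\<^bsub>A\<^esub> x i) * \<psi> (b \<cdot>\<^bsub>B\<^esub> y i))"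
    if xy: "\<forall>i<m. x i \<in> core A \<and> y i \<in> core B" for a b x y and m :: nat
  proof -
    have "(\<Sum>i<m. x i \<otimes> y i) \<in> C \<and> ?thesis"
      using xy by (induction m) (auto simp: T_simps F.zero F.add pure)
    then show ?thesis ..
  qed
  have square: "?F (T (tensor_adj A B t) t) =
      (\<Sum>i<m. \<Sum>j<m. \<omega> (adj A (x i) \<cdot>\<^bsub>A\<^esub> x j) * \<psi> (adj B (y i) \<cdot>\<^bsub>B\<^esub> y j))"
    if t: "t = (\<Sum>i<m. x i \<otimes> y i)" and xy: "\<forall>i<m. x i \<in> core A \<and> y i \<in> core B" for t x y and m :: nat
  proof -
    have "t \<in> C" unfolding t tensor_core_def
      using xy tensor_core_pure[of _ A _ B, unfolded tensor_core_def]
      by (intro complex_vector.span_sum) auto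
    then interpret R: Vector_Spaces.linear scaleC scaleC "\<lambda>s. T s t"
      using AB.right_mult_linear[of t] by simp
    have "tensor_adj A B t = (\<Sum>i<m. adj A (x i) \<otimes> adj B (y i))"
      using AB.adj_sum[of "\<lambda>i. x i \<otimes> y i"] by (simp add: t adj_pure)
    then have "?F (T (tensor_adj A B t) t) = (\<Sum>i<m. ?F (T (adj A (x i) \<otimes> adj B (y i)) t))"
      by (simp add: R.sum F.sum)
    also have "\<dots> = (\<Sum>i<m. \<Sum>j<m. \<omega> (adj A (x i) \<cdot>\<^bsub>A\<^esub> x j) * \<psi> (adj B (y i) \<cdot>\<^bsub>B\<^esub> y j))"
      unfolding t left[OF xy] ..
    finally show ?thesis .
  qed
  show ?thesis
    unfolding representable_def
  proof (intro conjI ballI allI)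
    show "Vector_Spaces.linear scaleC (*) ?F" by (rule F.linear_axioms)
  next
    fix t assume "t \<in> core (tensor_quasi_alg A B n)"
    then obtain x y and m :: nat where t: "t = (\<Sum>i<m. x i \<otimes> y i)"
      and xy: "\<forall>i<m. x i \<in> core A \<and> y i \<in> core B" using rep[of t] by auto
    have "0 \<le> (\<Sum>i<m. \<Sum>j<m. \<omega> (adj A (x i) \<cdot>\<^bsub>A\<^esub> x j) * \<psi> (adj B (y i) \<cdot>\<^bsub>B\<^esub> y j))"
      using xy by (intro schur_product_nonneg A.psd_gram[OF \<omega>] B.psd_gram[OF \<psi>]) auto
    then show "0 \<le> ?F (adj (tensor_quasi_alg A B n) t \<cdot>\<^bsub>tensor_quasi_alg A B n\<^esub> t)"
      by (simp add: square[OF t xy])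
  next
    fix s t u assume "s \<in> core (tensor_quasi_alg A B n)" "t \<in> core (tensor_quasi_alg A B n)"
    then have "s \<in> C" "t \<in> C" by simp_all
    then have "?F (T (T (tensor_adj A B t) (tensor_adj A B u)) s) =
        cnj (?F (T (T (tensor_adj A B s) u) t))"
    proof (induction s rule: C_induct)
      case (pure x y)
      from pure(3,1,2) show ?case
      proof (induction t rule: C_induct)
        case (pure x' y')
        then show ?case
          by (induction u rule: tensor_induct)
            (simp_all add: T_simps F.zero F.add tensor_functional_pure[OF lin]
              representable_herm[OF \<omega>, of x x'] representable_herm[OF \<psi>, of y y'])
      qed (simp_all add: T_simps F.zero F.add)
    qed (simp_all add: T_simps F.zero F.add)
    then show "?F (adj (tensor_quasi_alg A B n) t \<cdot>\<^bsub>tensor_quasi_alg A B n\<^esub>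
          adj (tensor_quasi_alg A B n) u \<cdot>\<^bsub>tensor_quasi_alg A B n\<^esub> s) =
        cnj (?F (adj (tensor_quasi_alg A B n) s \<cdot>\<^bsub>tensor_quasi_alg A B n\<^esub> u \<cdot>\<^bsub>tensor_quasi_alg A B n\<^esub> t))"
      by simp
  next
    fix u
    have "\<exists>\<gamma>>0. \<forall>t\<in>C. cmod (?F (T (tensor_adj A B u) t)) \<le> \<gamma> * sqrt (Re (?F (T (tensor_adj A B t) t)))"
    proof (induction u rule: tensor_induct)
      case zero
      \<comment> \<open>\<open>sqrt\<close> is negative at negative reals, so even the trivial bound
        for 0 requires (L.1).\<close>
      have "0 \<le> Re (?F (T (tensor_adj A B t) t))" if t: "t \<in> C" for t
      proof -
        obtain x y and m :: nat where t: "t = (\<Sum>i<m. x i \<otimes> y i)"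
          and xy: "\<forall>i<m. x i \<in> core A \<and> y i \<in> core B" using rep[OF t] by auto
        have "0 \<le> (\<Sum>i<m. \<Sum>j<m. \<omega> (adj A (x i) \<cdot>\<^bsub>A\<^esub> x j) * \<psi> (adj B (y i) \<cdot>\<^bsub>B\<^esub> y j))"
          using xy by (intro schur_product_nonneg A.psd_gram[OF \<omega>] B.psd_gram[OF \<psi>]) auto
        then show ?thesis unfolding square[OF t xy] by (simp add: less_eq_complex_def)
      qed
      then show ?case by (intro exI[of _ 1]) (simp add: T_simps F.zero)
    next
      case (pure a b)
      obtain \<alpha> where \<alpha>: "\<alpha> > 0" "\<And>x. x \<in> core A \<Longrightarrow>
          cmod (\<omega> (adj A a \<cdot>\<^bsub>A\<^esub> x)) \<le> \<alpha> * sqrt (Re (\<omega> (adj A x \<cdot>\<^bsub>A\<^esub> x)))"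
        using representable_bound[OF \<omega>, of a] by blast
      obtain \<beta> where \<beta>: "\<beta> > 0" "\<And>y. y \<in> core B \<Longrightarrow>
          cmod (\<psi> (adj B b \<cdot>\<^bsub>B\<^esub> y)) \<le> \<beta> * sqrt (Re (\<psi> (adj B y \<cdot>\<^bsub>B\<^esub> y)))"
        using representable_bound[OF \<psi>, of b] by blast
      have "cmod (?F (T (tensor_adj A B (a \<otimes> b)) t)) \<le> (\<alpha> * \<beta>) * sqrt (Re (?F (T (tensor_adj A B t) t)))"
        if t: "t \<in> C" for t
      proof -
        obtain x y and m :: nat where t: "t = (\<Sum>i<m. x i \<otimes> y i)"
          and xy: "\<forall>i<m. x i \<in> core A \<and> y i \<in> core B" using rep[OF t] by auto
        \<comment> \<open>The factors \<alpha> and \<beta> squared are put into the Gram matrices,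
          so that the Schur bound yields (L.3) with constant \<alpha> * \<beta>.\<close>
        define H where "H i j = complex_of_real (\<alpha>\<^sup>2) * \<omega> (adj A (x i) \<cdot>\<^bsub>A\<^esub> x j)" for i j
        define K where "K i j = complex_of_real (\<beta>\<^sup>2) * \<psi> (adj B (y i) \<cdot>\<^bsub>B\<^esub> y j)" for i j
        define f where "f i = \<omega> (adj A a \<cdot>\<^bsub>A\<^esub> x i)" for i
        define g where "g i = \<psi> (adj B b \<cdot>\<^bsub>B\<^esub> y i)" for i
        have H: "psd {..<m} (\<lambda>i j. H i j - cnj (f i) * f j)"
          unfolding H_def f_def using xy by (intro A.psd_gram_minus[OF \<omega>] \<alpha>(2)) auto
        have K: "psd {..<m} (\<lambda>i j. K i j - cnj (g i) * g j)"
          unfolding K_def g_def using xy by (intro B.psd_gram_minus[OF \<psi>] \<beta>(2)) auto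
        have "(cmod (\<Sum>i<m. f i * g i))\<^sup>2 \<le> Re (\<Sum>i<m. \<Sum>j<m. H i j * K i j)"
          by (rule schur_product_rank_one_bound[OF _ H K]) simp
        also have "(\<Sum>i<m. \<Sum>j<m. H i j * K i j) =
            complex_of_real ((\<alpha> * \<beta>)\<^sup>2) * ?F (T (tensor_adj A B t) t)"
          unfolding square[OF t xy] H_def K_def by (simp add: sum_distrib_left power_mult_distrib ac_simps)
        also have "Re \<dots> = (\<alpha> * \<beta>)\<^sup>2 * Re (?F (T (tensor_adj A B t) t))"
          by simp
        finally have "cmod (\<Sum>i<m. f i * g i) \<le> sqrt ((\<alpha> * \<beta>)\<^sup>2 * Re (?F (T (tensor_adj A B t) t)))"
          by (rule real_le_rsqrt)
        also have "\<dots> = \<alpha> * \<beta> * sqrt (Re (?F (T (tensor_adj A B t) t)))"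
          using \<alpha>(1) \<beta>(1) by (simp add: real_sqrt_mult)
        also have "(\<Sum>i<m. f i * g i) = ?F (T (tensor_adj A B (a \<otimes> b)) t)"
          unfolding f_def g_def by (simp add: adj_pure t left[OF xy])
        finally show ?thesis .
      qed
      then show ?case using \<alpha>(1) \<beta>(1) by (intro exI[of _ "\<alpha> * \<beta>"]) simp
    next
      case (add u v)
      then obtain \<alpha> \<beta> where \<alpha>: "\<alpha> > 0" "\<And>t. t \<in> C \<Longrightarrow>
          cmod (?F (T (tensor_adj A B u) t)) \<le> \<alpha> * sqrt (Re (?F (T (tensor_adj A B t) t)))"
        and \<beta>: "\<beta> > 0" "\<And>t. t \<in> C \<Longrightarrow>
          cmod (?F (T (tensor_adj A B v) t)) \<le> \<beta> * sqrt (Re (?F (T (tensor_adj A B t) t)))"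
        by blast
      have "cmod (?F (T (tensor_adj A B (u + v)) t)) \<le>
          (\<alpha> + \<beta>) * sqrt (Re (?F (T (tensor_adj A B t) t)))" if t: "t \<in> C" for t
        using norm_triangle_mono[OF \<alpha>(2)[OF t] \<beta>(2)[OF t]] t
        by (simp add: T_simps F.add distrib_right)
      then show ?case using \<alpha>(1) \<beta>(1) by (intro exI[of _ "\<alpha> + \<beta>"]) simp
    qed
    then show "\<exists>\<gamma>>0. \<forall>t\<in>core (tensor_quasi_alg A B n).
        cmod (?F (adj (tensor_quasi_alg A B n) u \<cdot>\<^bsub>tensor_quasi_alg A B n\<^esub> t))
        \<le> \<gamma> * sqrt (Re (?F (adj (tensor_quasi_alg A B n) t \<cdot>\<^bsub>tensor_quasi_alg A B n\<^esub> t)))"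
      by simp
  qed
qed

text \<open>Uniformity applied to the rank one operators \<open>\<omega>(\<cdot>) e\<close> and \<open>\<psi>(\<cdot>) f\<close>, where \<open>e\<close> and \<open>f\<close>
  are the units, bounds the product functional.\<close>

lemma cont_representable_tensor_functional:
  assumes \<omega>: "\<omega> \<in> cont_representable A" and \<psi>: "\<psi> \<in> cont_representable B"
    and n: "uniform_cross_norm (nrm A) (nrm B) n"
  shows "tensor_functional \<omega> \<psi> \<in> cont_representable (tensor_quasi_alg A B n)"
proof -
  have rep: "representable A \<omega>" "representable B \<psi>"
    using \<omega> \<psi> by (auto simp: cont_representable_def)
  note lin = representable_linear[OF rep(1)] representable_linear[OF rep(2)]
  let ?F = "tensor_functional \<omega> \<psi>"
  interpret \<omega>: Vector_Spaces.linear scaleC "(*)" \<omega> by (rule lin)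
  interpret \<psi>: Vector_Spaces.linear scaleC "(*)" \<psi> by (rule lin)
  interpret F: Vector_Spaces.linear scaleC "(*)" ?F by (rule linear_tensor_functional[OF lin])
  have n': "is_norm n" "\<And>a b. n (a \<otimes> b) = nrm A a * nrm B b"
    using n by (auto simp: uniform_cross_norm_def cross_norm_def)
  obtain e f where e: "nrm A e = 1" and f: "nrm B f = 1"
    using A.unital B.unital by blast
  define T1 where "T1 a = \<omega> a *\<^sub>C e" for a
  define T2 where "T2 b = \<psi> b *\<^sub>C f" for b
  have "\<exists>K. \<forall>a. cmod (\<omega> a) \<le> K * nrm A a" "\<exists>K. \<forall>b. cmod (\<psi> b) \<le> K * nrm B b"
    using \<omega> \<psi> continuous_functional_iff[OF A.is_norm lin(1)] continuous_functional_iff[OF B.is_norm lin(2)]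
    by (auto simp: cont_representable_def)
  then have bdd: "bounded_operator (nrm A) T1" "bounded_operator (nrm B) T2"
    unfolding bounded_operator_def T1_def T2_def
    by (simp_all add: linear_scaleC_iff \<omega>.add \<omega>.scale \<psi>.add \<psi>.scale scaleC_add_left scaleC_scaleC
        is_norm_scale[OF A.is_norm] is_norm_scale[OF B.is_norm] e f)
  then have lin12: "Vector_Spaces.linear scaleC scaleC T1" "Vector_Spaces.linear scaleC scaleC T2"
    unfolding bounded_operator_def by blast+
  interpret T12: Vector_Spaces.linear scaleC scaleC "tensor_map T1 T2"
    by (rule linear_tensor_map[OF lin12])
  have pure: "tensor_map T1 T2 (a \<otimes> b) = (\<omega> a * \<psi> b) *\<^sub>C (e \<otimes> f)" for a b
    unfolding tensor_map_pure[OF lin12]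
    by (simp add: T1_def T2_def tensor_scale_left tensor_scale_right scaleC_scaleC)
  have "tensor_map T1 T2 t = ?F t *\<^sub>C (e \<otimes> f)" for t
    by (induction t rule: tensor_induct)
      (simp_all add: T12.zero T12.add F.zero F.add scaleC_add_left pure
        tensor_functional_pure[OF lin])
  \<comment> \<open>All values lie on the line through \<open>e \<otimes> f\<close>, a vector of
    norm 1 by the cross-norm property.\<close>
  then have "n (tensor_map T1 T2 t) = cmod (?F t)" for t
    by (simp add: is_norm_scale[OF n'(1)] n'(2) e f)
  moreover have "bounded_operator n (tensor_map T1 T2)"
    using n bdd unfolding uniform_cross_norm_def by blast
  ultimately have "\<exists>K. \<forall>t. cmod (?F t) \<le> K * n t"
    unfolding bounded_operator_def by simp
  then have "continuous_map (norm_topology n) euclidean ?F"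
    unfolding continuous_functional_iff[OF n'(1) F.linear_axioms] .
  then show ?thesis
    using representable_tensor_functional[OF rep] by (simp add: cont_representable_def tensor_quasi_alg_def)
qed

end

section \<open>Separation of points on the tensor product\<close>

lemma tensor_basis_expansion:
  fixes t :: "('a::complex_vector, 'b::complex_vector) tensor"
  assumes E: "complex_vector.span E = (UNIV :: 'b set)"
  shows "\<exists>S g. finite S \<and> S \<subseteq> E \<and> t = (\<Sum>b\<in>S. g b \<otimes> b)"
proof (induction t rule: tensor_induct)
  case zero
  then show ?case by (intro exI[of _ "{}"]) simp
next
  case (pure a b)
  have "b \<in> complex_vector.span E" by (simp add: E)
  then obtain S c where "finite S" "S \<subseteq> E" "b = (\<Sum>v\<in>S. c v *\<^sub>C v)"
    unfolding complex_vector.span_explicit by blast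
  then show ?case
    by (intro exI[of _ S] exI[of _ "\<lambda>v. c v *\<^sub>C a"])
      (simp add: tensor_sum_right tensor_scale_left tensor_scale_right)
next
  case (add s t)
  then obtain S g S' g' where S: "finite S" "S \<subseteq> E" "s = (\<Sum>b\<in>S. g b \<otimes> b)"
    and S': "finite S'" "S' \<subseteq> E" "t = (\<Sum>b\<in>S'. g' b \<otimes> b)" by blast
  \<comment> \<open>Extending both coefficient families by 0 to the union of the supports allows
    them to be added.\<close>
  define h where "h b = (if b \<in> S then g b else 0)" for b
  define h' where "h' b = (if b \<in> S' then g' b else 0)" for b
  have "s = (\<Sum>b\<in>S \<union> S'. h b \<otimes> b)"
    unfolding S(3) h_def using S S' by (intro sum.mono_neutral_cong_left) auto
  moreover have "t = (\<Sum>b\<in>S \<union> S'. h' b \<otimes> b)"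
    unfolding S'(3) h'_def using S S' by (intro sum.mono_neutral_cong_left) auto
  ultimately have "s + t = (\<Sum>b\<in>S \<union> S'. (h b + h' b) \<otimes> b)"
    by (simp add: tensor_add_left sum.distrib)
  then show ?case
    using S S' by (intro exI[of _ "S \<union> S'"] exI[of _ "\<lambda>b. h b + h' b"]) auto
qed

text \<open>Write \<open>t\<close> with linearly independent second factors. Varying \<psi> shows
  that the combination of these factors with coefficients \<open>\<omega> (g v)\<close> is 0,
  independence makes each coefficient 0, and varying \<omega> makes each \<open>g v\<close> equal to
  0.\<close>

lemma tensor_functional_separating:
  fixes X :: "('a::complex_vector \<Rightarrow> complex) set" and Y :: "('b::complex_vector \<Rightarrow> complex) set"
  assumes X: "\<And>\<omega>. \<omega> \<in> X \<Longrightarrow> Vector_Spaces.linear scaleC (*) \<omega>"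
    "\<And>a. (\<And>\<omega>. \<omega> \<in> X \<Longrightarrow> \<omega> a = 0) \<Longrightarrow> a = 0"
    and Y: "\<And>\<psi>. \<psi> \<in> Y \<Longrightarrow> Vector_Spaces.linear scaleC (*) \<psi>"
    "\<And>b. (\<And>\<psi>. \<psi> \<in> Y \<Longrightarrow> \<psi> b = 0) \<Longrightarrow> b = 0"
    and zero: "\<And>\<omega> \<psi>. \<lbrakk>\<omega> \<in> X; \<psi> \<in> Y\<rbrakk> \<Longrightarrow> tensor_functional \<omega> \<psi> t = 0"
  shows "t = 0"
proof -
  obtain E :: "'b set" where E: "complex_vector.independent E" "UNIV \<subseteq> complex_vector.span E"
    using complex_vector.maximal_independent_subset[of UNIV] by metis
  obtain S g where S: "finite S" "S \<subseteq> E" and t: "t = (\<Sum>b\<in>S. g b \<otimes> b)"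
    using tensor_basis_expansion[of E t] E(2) by blast
  have indep: "complex_vector.independent S" using complex_vector.independent_mono[OF E(1) S(2)] .
  have "g b = 0" if b: "b \<in> S" for b
  proof (rule X(2))
    fix \<omega> assume \<omega>: "\<omega> \<in> X"
    have "(\<Sum>v\<in>S. \<omega> (g v) *\<^sub>C v) = 0"
    proof (rule Y(2))
      fix \<psi> assume \<psi>: "\<psi> \<in> Y"
      interpret \<psi>: Vector_Spaces.linear scaleC "(*)" \<psi> by (rule Y(1)[OF \<psi>])
      note lin = X(1)[OF \<omega>] Y(1)[OF \<psi>]
      interpret F: Vector_Spaces.linear scaleC "(*)" "tensor_functional \<omega> \<psi>"
        by (rule linear_tensor_functional[OF lin])
      show "\<psi> (\<Sum>v\<in>S. \<omega> (g v) *\<^sub>C v) = 0"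
        using zero[OF \<omega> \<psi>] by (simp add: t F.sum tensor_functional_pure[OF lin] \<psi>.sum \<psi>.scale)
    qed
    then show "\<omega> (g b) = 0"
      using complex_vector.independentD[OF indep S(1) order_refl _ b, of "\<lambda>v. \<omega> (g v)"] by blast
  qed
  then show ?thesis by (simp add: t)
qed

section \<open>Full representability of the tensor product\<close>

theorem theorem6p18:
  fixes A :: "'a::complex_vector quasi_alg"
    and B :: "'b::complex_vector quasi_alg"
    and n :: "('a, 'b) tensor \<Rightarrow> real"
  assumes "banach_quasi_star_algebra A" and "fully_representable A" and "condition_P A"
    and "banach_quasi_star_algebra B" and "fully_representable B" and "condition_P B"
    and "uniform_cross_norm (nrm A) (nrm B) n"
    and "\<And>t. n (tensor_adj A B t) = n t"
    and "barrelled n"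
  shows "fully_representable (tensor_quasi_alg A B n)"
proof -
  have A: "normed_quasi_star_algebra A" "sufficient A"
    and B: "normed_quasi_star_algebra B" "sufficient B"
    using assms(2,5) by (auto simp: fully_representable_def)
  interpret A: normed_quasi_star_algebra A by (rule A)
  interpret B: normed_quasi_star_algebra B by (rule B)
  interpret normed_quasi_star_algebra_pair A B ..
  interpret AB: normed_quasi_star_algebra "tensor_quasi_alg A B n"
    by (rule normed_quasi_star_algebra_tensor[OF A(1) B(1) assms(7,8)])
  have "\<exists>\<omega>\<in>cont_representable (tensor_quasi_alg A B n). 0 < \<omega> t"
    if t: "t \<in> positive_cone (tensor_quasi_alg A B n)" "t \<noteq> 0" for t
  proof -
    obtain \<omega> \<psi> where \<omega>: "\<omega> \<in> cont_representable A" and \<psi>: "\<psi> \<in> cont_representable B"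
      and nz: "tensor_functional \<omega> \<psi> t \<noteq> 0"
    \<comment> \<open>If no pair worked, all product functionals would vanish at \<open>t\<close>,
      against separation of points.\<close>
    proof (rule ccontr)
      note obtained = that
      assume "\<not> thesis"
      then have zero: "tensor_functional \<omega> \<psi> t = 0"
        if "\<omega> \<in> cont_representable A" "\<psi> \<in> cont_representable B" for \<omega> \<psi>
        using obtained[OF that] \<open>\<not> thesis\<close> by blast
      have "t = 0"
      proof (rule tensor_functional_separating)
        show "Vector_Spaces.linear scaleC (*) \<omega>" if "\<omega> \<in> cont_representable A" for \<omega>
          using that by (auto simp: cont_representable_def intro: representable_linear)
        show "Vector_Spaces.linear scaleC (*) \<psi>" if "\<psi> \<in> cont_representable B" for \<psi>
          using that by (auto simp: cont_representable_def intro: representable_linear)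
        show "a = 0" if "\<And>\<omega>. \<omega> \<in> cont_representable A \<Longrightarrow> \<omega> a = 0" for a
          by (rule A.cont_representable_separating[OF A(2) assms(3) that])
        show "b = 0" if "\<And>\<psi>. \<psi> \<in> cont_representable B \<Longrightarrow> \<psi> b = 0" for b
          by (rule B.cont_representable_separating[OF B(2) assms(6) that])
      qed (rule zero)
      with t(2) show False ..
    qed
    note F = cont_representable_tensor_functional[OF \<omega> \<psi> assms(7)]
    \<comment> \<open>The product functional itself serves: on the cone its value is nonnegative,
      and here it is not 0.\<close>
    show ?thesis
      using AB.cont_representable_nonneg[OF F t(1)] nz F by (intro bexI[OF _ F]) (simp add: order_less_le)
  qed
  then have "sufficient (tensor_quasi_alg A B n)" unfolding sufficient_def by blast
  moreover have "common_domain (tensor_quasi_alg A B n) = UNIV"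
    using assms(9) by (intro AB.barrelled_common_domain) (simp add: tensor_quasi_alg_def)
  ultimately show ?thesis
    unfolding fully_representable_def using AB.normed_quasi_star_algebra_axioms by blast
qed

end
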